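(* Let $G_1$ be the directed graph on three distinct vertices $x,y,z$ whose edges are the three loops together with $(x,y)$ and $(y,z)$ (and no others), and let $G_2$ be the directed graph on three distinct vertices $p_1,p_2,x$ whose edges are the three loops together with $(p_1,x)$ and $(p_2,x)$ (and no others). A Matoušek USO is realizable if and only if its dimension influence graph contains neither $G_1$ nor $G_2$ as an induced subgraph (up to graph isomorphism). Furthermore, every realizable Matoušek USO $m$ can be realized by a simple extension of a cyclic-P-matroid with $q$ as the last element of $\pi$, i.e., $m$ is the USO associated with such an extension.
   Context: Hypercube orientations and USOs. Let $n\ge 1$, $[n]=\{1,\dots,n\}$, let $P([n])$ be its power set, and let $\oplus$ denote symmetric difference. An orientation of the $n$-dimensional hypercube is a function $o:P([n])\to P([n])$ (assigning each vertex its outmap) such that for all $v\in P([n])$ and $d\in[n]$: $d\in o(v)$ iff $d\notin o(v\oplus\{d\})$. It is a unique sink orientation (USO) if each face (subcube) $F$, spanned by a set of dimensions $D_F\subseteq[n]$, contains exactly one vertex $v$ with $o(v)\cap D_F=\emptyset$. Matoušek USOs. Let $G=([n],E)$ be a directed graph with a loop $(d,d)\in E$ for every $d\in[n]$ and no other directed cycles. The Matoušek USO with dimension influence graph $G$ is the unique orientation $m$ with $m(\emptyset)=\emptyset$ such that for all $d,d'\in[n]$ and all $v\in P([n])$: exactly one of $d'\in m(v)$, $d'\in m(v\oplus\{d\})$ holds if and only if $(d,d')\in E$. Realizability. A P-matrix is a real square matrix all of whose principal minors are positive. Given a P-matrix $M\in\mathbb{R}^{n\times n}$ and $q\in\mathbb{R}^n$,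 a candidate solution is a pair $(w,z)\in\mathbb{R}^n\times\mathbb{R}^n$ with $w-Mz=q$ and, for every $i$, $w_i=0$ or $z_i=0$. For every $B\subseteq[n]$ there is a unique candidate solution with $w_i=0$ for $i\in B$ and $z_i=0$ for $i\notin B$; $(M,q)$ is non-degenerate if in none of these is there an $i$ with $w_i=z_i=0$. A non-degenerate $(M,q)$ realizes the USO $o$ where $o(B)$ is the set of $i$ with $w_i,z_i\le 0$ in the candidate solution corresponding to $B$. A USO is realizable if it is realized by some non-degenerate $(M,q)$. Oriented matroids. Oriented matroids are given by their collection $\mathcal{C}$ of signed circuits $C=(C^+,C^-)$, with support $\underline{C}=C^+\cup C^-$. For a basis $B$ and an element $e\notin B$, the fundamental circuit $C(B,e)$ is the unique circuit with $e\in C(B,e)^+$ and support contained in $B\cup\{e\}$. For $F$ a subset of the ground set, ${}_{-F}\mathcal{M}$ is obtained by flipping the sign of all elements of $F$ in all circuits; for a permutation $\pi$, $\pi\cdot\mathcal{M}$ is obtained by relabeling all elements by $\pi$ in all circuits. The alternating matroid $\mathcal{A}^{N,r}$ on a linearly ordered ground set of $N$ elements is the rank-$r$ oriented matroid realized by the vectors $(1,x_i,x_i^2,\dots,x_i^{r-1})$ with $x_1<\dots<x_N$ (listed in the ground set order); it is uniform, and the circuits are the signed sets with support of size $r+1$ whose signs alternate along the order. P-matroids. Let $E_{2n}=[2n]$; the elements $i$ and $i+n$ ($i\in[n]$) are complementary, written $\overline{i}=i+n$ and $\overline{i+n}=i$. A P-matroid is an oriented matroid on $E_{2n}$ for which $[n]$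 is a basis (and every set of $n$ elements without a complementary pair is a basis), and which has no circuit $C$ such that $\underline{C}$ contains exactly one complementary pair $\{e,\overline{e}\}$ and $e,\overline{e}$ have different signs in $C$. A cyclic-P-matroid is a P-matroid $\mathcal{M}$ with $\pi\cdot({}_{-F}\mathcal{M})=\mathcal{A}^{2n,n}$ for some permutation $\pi$ of $E_{2n}$ and some $F\subseteq E_{2n}$. Simple extensions. A simple extension of a cyclic-P-matroid is an oriented matroid $\hat{\mathcal{M}}$ on $\hat{E}_{2n}=E_{2n}\cup\{q\}$ with $\pi\cdot({}_{-F}\hat{\mathcal{M}})=\mathcal{A}^{2n+1,n}$ for some permutation $\pi$ of $\hat{E}_{2n}$ with $\pi(q)=q$ and some $F\subseteq\hat{E}_{2n}$, where the ground set of $\mathcal{A}^{2n+1,n}$ is $E_{2n}\cup\{q\}$, linearly ordered by $1<2<\dots<2n$ with $q$ inserted at some position, and such that $\pi$ and $F$ restricted to $E_{2n}$ are such that the restricted oriented matroid is a cyclic-P-matroid; equivalently: (i) for all $e\in E_{2n}$ with $\pi(e)<\pi(\overline{e})$ and all $f\in E_{2n}$, $\pi(f)\in[\pi(e),\pi(\overline{e})]\Leftrightarrow\pi(\overline{f})\in[\pi(e),\pi(\overline{e})]$ (positions in $[2n]$), and (ii) for every $e\in E_{2n}$, exactly one of $e,\overline{e}$ is in $F$ if $\frac{|\pi(e)-\pi(\overline{e})|-1}{2}$ is even, and both or none are in $F$ otherwise. "$q$ is the last element of $\pi$" means that $q$ is inserted after $2n$. The USO $u$ associated with $\hat{\mathcal{M}}$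 is defined as follows: for $v\in P([n])$ let $C_v=C(\{i: i\in[n]\setminus v\}\cup\{i+n: i\in v\},\,q)$; then $i\in u(v)$ iff $i\in C_v^-$ or $i+n\in C_v^-$. *)

theory Defs
  imports
    Complex_Main
    "HOL-Combinatorics.Permutations"
    "Jordan_Normal_Form.DL_Submatrix"
    "Jordan_Normal_Form.Determinant"
    "Graph_Theory.Graph_Theory"
begin

text \<open>
  All index sets are zero-based, in agreement with the matrix library: the dimensions \<open>[n]\<close> are
  \<open>{..<n}\<close>, the ground set \<open>E\<^sub>2\<^sub>n\<close> is \<open>{..<2*n}\<close>, the complement of \<open>i < n\<close> is \<open>i + n\<close>,
  and the extension element \<open>q\<close> is the number \<open>2*n\<close>.
\<close>

section \<open>Orientations and unique sink orientations\<close>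

text \<open>Orientations are functions on all sets of naturals; only their values on subsets of
  \<open>{..<n}\<close> are meaningful.\<close>

definition orientation :: "nat \<Rightarrow> (nat set \<Rightarrow> nat set) \<Rightarrow> bool" where
  "orientation n out \<longleftrightarrow>
     (\<forall>v. v \<subseteq> {..<n} \<longrightarrow> out v \<subseteq> {..<n} \<and>
        (\<forall>d<n. d \<in> out v \<longleftrightarrow> d \<notin> out (sym_diff v {d})))"

text \<open>The face through \<open>u\<close> spanned by the dimensions in \<open>D\<close>.\<close>

definition face :: "nat \<Rightarrow> nat set \<Rightarrow> nat set \<Rightarrow> nat set set" where
  "face n D u = {v. v \<subseteq> {..<n} \<and> v - D = u - D}"

definition USO :: "nat \<Rightarrow> (nat set \<Rightarrow> nat set) \<Rightarrow> bool" where
  "USO n out \<longleftrightarrow> orientation n out \<and>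
     (\<forall>D u. D \<subseteq> {..<n} \<longrightarrow> u \<subseteq> {..<n} \<longrightarrow> (\<exists>!v. v \<in> face n D u \<and> out v \<inter> D = {}))"


section \<open>Matousek USOs\<close>

definition dimension_influence_graph :: "nat \<Rightarrow> nat pair_pre_digraph \<Rightarrow> bool" where
  "dimension_influence_graph n G \<longleftrightarrow>
     pair_wf_digraph G \<and> pverts G = {..<n} \<and>
     (\<forall>d<n. (d, d) \<in> parcs G) \<and>
     (\<forall>p. pre_digraph.cycle (with_proj G) p \<longrightarrow> (\<exists>d. p = [(d, d)]))"

definition matousek_USO :: "nat \<Rightarrow> nat pair_pre_digraph \<Rightarrow> (nat set \<Rightarrow> nat set) \<Rightarrow> bool" where
  "matousek_USO n G m \<longleftrightarrow>
     dimension_influence_graph n G \<and> orientation n m \<and> m {} = {} \<and>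
     (\<forall>d<n. \<forall>d'<n. \<forall>v. v \<subseteq> {..<n} \<longrightarrow>
        ((d' \<in> m v) \<noteq> (d' \<in> m (sym_diff v {d})) \<longleftrightarrow> (d, d') \<in> parcs G))"

definition graph_G1 :: "nat pair_pre_digraph" where
  "graph_G1 = \<lparr> pverts = {0, 1, 2}, parcs = {(0, 0), (1, 1), (2, 2), (0, 1), (1, 2)} \<rparr>"

definition graph_G2 :: "nat pair_pre_digraph" where
  "graph_G2 = \<lparr> pverts = {0, 1, 2}, parcs = {(0, 0), (1, 1), (2, 2), (0, 2), (1, 2)} \<rparr>"

definition contains_induced :: "'a pair_pre_digraph \<Rightarrow> 'b pair_pre_digraph \<Rightarrow> bool" where
  "contains_induced G H \<longleftrightarrow>
     (\<exists>K. induced_subgraph K (with_proj G) \<and> digraph_iso K (with_proj H))"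


section \<open>Realizability by P-matrices\<close>

definition P_matrix :: "nat \<Rightarrow> real mat \<Rightarrow> bool" where
  "P_matrix n M \<longleftrightarrow> M \<in> carrier_mat n n \<and>
     (\<forall>S. S \<subseteq> {..<n} \<and> S \<noteq> {} \<longrightarrow> det (submatrix M S S) > 0)"

definition candidate_solution :: "nat \<Rightarrow> real mat \<Rightarrow> real vec \<Rightarrow> real vec \<Rightarrow> real vec \<Rightarrow> bool" where
  "candidate_solution n M q w z \<longleftrightarrow>
     w \<in> carrier_vec n \<and> z \<in> carrier_vec n \<and> w - M *\<^sub>v z = q \<and>
     (\<forall>i<n. w $ i = 0 \<or> z $ i = 0)"

definition candidate_solution_at ::
    "nat \<Rightarrow> real mat \<Rightarrow> real vec \<Rightarrow> nat set \<Rightarrow> real vec \<Rightarrow> real vec \<Rightarrow> bool" where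
  "candidate_solution_at n M q B w z \<longleftrightarrow> candidate_solution n M q w z \<and>
     (\<forall>i<n. (i \<in> B \<longrightarrow> w $ i = 0) \<and> (i \<notin> B \<longrightarrow> z $ i = 0))"

definition nondegenerate :: "nat \<Rightarrow> real mat \<Rightarrow> real vec \<Rightarrow> bool" where
  "nondegenerate n M q \<longleftrightarrow>
     (\<forall>B w z. B \<subseteq> {..<n} \<longrightarrow> candidate_solution_at n M q B w z \<longrightarrow>
        \<not> (\<exists>i<n. w $ i = 0 \<and> z $ i = 0))"

definition realizes :: "nat \<Rightarrow> real mat \<Rightarrow> real vec \<Rightarrow> (nat set \<Rightarrow> nat set) \<Rightarrow> bool" where
  "realizes n M q out \<longleftrightarrow>
     (\<forall>B. B \<subseteq> {..<n} \<longrightarrow>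
        (\<exists>w z. candidate_solution_at n M q B w z \<and>
               out B = {i. i < n \<and> w $ i \<le> 0 \<and> z $ i \<le> 0}))"

definition realizable :: "nat \<Rightarrow> (nat set \<Rightarrow> nat set) \<Rightarrow> bool" where
  "realizable n out \<longleftrightarrow> USO n out \<and>
     (\<exists>M q. P_matrix n M \<and> q \<in> carrier_vec n \<and> nondegenerate n M q \<and> realizes n M q out)"


section \<open>Oriented matroids\<close>

text \<open>A signed set \<open>(P, N)\<close> consists of its positive and its negative part. An oriented matroid is
  represented by its ground set and its collection of signed circuits.\<close>

type_synonym 'a signed_set = "'a set \<times> 'a set"

definition supp :: "'a signed_set \<Rightarrow> 'a set" where
  "supp C = fst C \<union> snd C"

definition opposite :: "'a signed_set \<Rightarrow> 'a signed_set" where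
  "opposite C = (snd C, fst C)"

definition oriented_matroid :: "'a set \<Rightarrow> 'a signed_set set \<Rightarrow> bool" where
  "oriented_matroid E \<C> \<longleftrightarrow>
     finite E \<and>
     (\<forall>C\<in>\<C>. fst C \<inter> snd C = {} \<and> supp C \<subseteq> E) \<and>
     ({}, {}) \<notin> \<C> \<and>
     (\<forall>C\<in>\<C>. opposite C \<in> \<C>) \<and>
     (\<forall>C\<in>\<C>. \<forall>D\<in>\<C>. supp C \<subseteq> supp D \<longrightarrow> C = D \<or> C = opposite D) \<and>
     (\<forall>C\<in>\<C>. \<forall>D\<in>\<C>. \<forall>e. C \<noteq> opposite D \<and> e \<in> fst C \<inter> snd D \<longrightarrow>
        (\<exists>Z\<in>\<C>. fst Z \<subseteq> (fst C \<union> fst D) - {e} \<and> snd Z \<subseteq> (snd C \<union> snd D) - {e}))"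

definition om_independent :: "'a set \<Rightarrow> 'a signed_set set \<Rightarrow> 'a set \<Rightarrow> bool" where
  "om_independent E \<C> X \<longleftrightarrow> X \<subseteq> E \<and> \<not> (\<exists>C\<in>\<C>. supp C \<subseteq> X)"

definition om_basis :: "'a set \<Rightarrow> 'a signed_set set \<Rightarrow> 'a set \<Rightarrow> bool" where
  "om_basis E \<C> B \<longleftrightarrow> om_independent E \<C> B \<and> (\<forall>X. om_independent E \<C> X \<and> B \<subseteq> X \<longrightarrow> X = B)"

definition fundamental_circuit :: "'a signed_set set \<Rightarrow> 'a set \<Rightarrow> 'a \<Rightarrow> 'a signed_set" where
  "fundamental_circuit \<C> B e = (THE C. C \<in> \<C> \<and> e \<in> fst C \<and> supp C \<subseteq> insert e B)"

definition reorient :: "'a set \<Rightarrow> 'a signed_set set \<Rightarrow> 'a signed_set set" where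
  "reorient F \<C> = (\<lambda>(P, N). ((P - F) \<union> (N \<inter> F), (N - F) \<union> (P \<inter> F))) ` \<C>"

definition relabel :: "('a \<Rightarrow> 'b) \<Rightarrow> 'a signed_set set \<Rightarrow> 'b signed_set set" where
  "relabel \<pi> \<C> = (\<lambda>(P, N). (\<pi> ` P, \<pi> ` N)) ` \<C>"

definition restriction :: "'a signed_set set \<Rightarrow> 'a set \<Rightarrow> 'a signed_set set" where
  "restriction \<C> E = {C \<in> \<C>. supp C \<subseteq> E}"


section \<open>The alternating matroid\<close>

text \<open>Linear dependences among the vectors \<open>V e = (V e 0, \<dots>, V e (r - 1))\<close>, for \<open>e \<in> E\<close>.\<close>

definition lin_dependence :: "'a set \<Rightarrow> nat \<Rightarrow> ('a \<Rightarrow> nat \<Rightarrow> real) \<Rightarrow> ('a \<Rightarrow> real) \<Rightarrow> bool" where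
  "lin_dependence E r V c \<longleftrightarrow>
     (\<forall>e. e \<notin> E \<longrightarrow> c e = 0) \<and> (\<forall>k<r. (\<Sum>e\<in>E. c e * V e k) = 0)"

text \<open>The circuits of the oriented matroid realized by a vector configuration are the sign patterns
  of its nonzero linear dependences of inclusion-minimal support.\<close>

definition vector_circuits :: "'a set \<Rightarrow> nat \<Rightarrow> ('a \<Rightarrow> nat \<Rightarrow> real) \<Rightarrow> 'a signed_set set" where
  "vector_circuits E r V =
     {({e. c e > 0}, {e. c e < 0}) | c.
        lin_dependence E r V c \<and> (\<exists>e. c e \<noteq> 0) \<and>
        (\<forall>c'. lin_dependence E r V c' \<and> (\<exists>e. c' e \<noteq> 0) \<and> {e. c' e \<noteq> 0} \<subseteq> {e. c e \<noteq> 0} \<longrightarrow>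
              {e. c' e \<noteq> 0} = {e. c e \<noteq> 0})}"

text \<open>The ground set is the set of entries of the list \<open>xs\<close>, ordered as in the list. We take
  \<open>x\<^sub>i = i\<close>; any other strictly increasing choice gives the same circuits, by
  \<open>vector_circuits_moment_curve\<close> below.\<close>

definition alternating_matroid :: "'a list \<Rightarrow> nat \<Rightarrow> 'a signed_set set" where
  "alternating_matroid xs r =
     relabel ((!) xs) (vector_circuits {..<length xs} r (\<lambda>i k. real i ^ k))"

definition alternates :: "'a::linorder signed_set \<Rightarrow> bool" where
  "alternates C \<longleftrightarrow> fst C \<inter> snd C = {} \<and>
     (\<forall>i\<in>supp C. \<forall>j\<in>supp C. i < j \<and> {i<..<j} \<inter> supp C = {} \<longrightarrow> (i \<in> fst C \<longleftrightarrow> j \<in> snd C))"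

lemma dependence_poly:
  assumes dep: "lin_dependence {..<N} r (\<lambda>i k. x i ^ k) c" and deg: "degree p < r"
  shows "(\<Sum>i<N. c i * poly p (x i)) = 0"
proof -
  have "(\<Sum>i<N. c i * poly p (x i)) =
        (\<Sum>i<N. \<Sum>k\<le>degree p. coeff p k * (c i * x i ^ k))"
    by (simp add: poly_altdef sum_distrib_left mult_ac)
  also have "\<dots> = (\<Sum>k\<le>degree p. coeff p k * (\<Sum>i<N. c i * x i ^ k))"
    by (subst sum.swap) (simp add: sum_distrib_left)
  also have "\<dots> = 0"
    using dep deg by (intro sum.neutral) (auto simp: lin_dependence_def)
  finally show ?thesis .
qed

lemma degree_prod_roots:
  fixes x :: "nat \<Rightarrow> real"
  assumes "finite S"
  shows "degree (\<Prod>f\<in>S. [:- x f, 1:]) = card S" "lead_coeff (\<Prod>f\<in>S. [:- x f, 1:]) = 1"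
  using assms by (subst degree_prod_eq_sum_degree; auto) (simp add: lead_coeff_prod)

lemma dependence_support_card:
  fixes x :: "nat \<Rightarrow> real"
  assumes dep: "lin_dependence {..<N} r (\<lambda>i k. x i ^ k) c" and x: "inj_on x {..<N}"
    and e: "c e \<noteq> 0"
  shows "r < card {e. c e \<noteq> 0}"
proof (rule ccontr)
  define S where "S = {e. c e \<noteq> 0}"
  assume "\<not> r < card {e. c e \<noteq> 0}"
  hence le: "card S \<le> r" by (simp add: S_def)
  have SN: "S \<subseteq> {..<N}" using dep by (auto simp: S_def lin_dependence_def)
  hence fin: "finite S" by (rule finite_subset) simp
  have eS: "e \<in> S" using e by (simp add: S_def)
  define p where "p = (\<Prod>f\<in>S - {e}. [:- x f, 1:])"
  have "degree p = card (S - {e})" using fin by (simp add: p_def degree_prod_roots)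
  also have "\<dots> < card S" using fin eS by (rule card_Diff1_less)
  also note le
  finally have "degree p < r" .
  hence "0 = (\<Sum>i<N. c i * poly p (x i))" using dependence_poly[OF dep] by simp
  also have "\<dots> = (\<Sum>i\<in>{e}. c i * poly p (x i))"
  proof (rule sum.mono_neutral_right)
    show "\<forall>i\<in>{..<N} - {e}. c i * poly p (x i) = 0"
      using fin by (auto simp: p_def poly_prod S_def)
  qed (use eS SN in auto)
  finally have "poly p (x e) = 0" using e by simp
  then obtain f where "f \<in> S - {e}" "x e = x f" using fin by (auto simp: p_def poly_prod)
  thus False using x eS SN by (auto simp: inj_on_def)
qed

lemma dependence_exists:
  fixes x :: "nat \<Rightarrow> real"
  assumes x: "inj_on x {..<N}" and SN: "S \<subseteq> {..<N}" and card: "card S = Suc r"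
  obtains c where "lin_dependence {..<N} r (\<lambda>i k. x i ^ k) c" "{e. c e \<noteq> 0} = S"
proof -
  have fin: "finite S" using SN by (rule finite_subset) simp
  define L where "L e = (\<Prod>f\<in>S - {e}. [:- x f, 1:])" for e
  define c where "c e = (if e \<in> S then 1 / poly (L e) (x e) else 0)" for e
  have L0: "poly (L e) (x f) = 0 \<longleftrightarrow> f \<noteq> e" if "e \<in> S" "f \<in> S" for e f
    using that fin x SN by (auto simp: L_def poly_prod inj_on_def)
  have degL: "degree (L e) = r" "coeff (L e) r = 1" if "e \<in> S" for e
  proof -
    have "card (S - {e}) = r" using that card fin by simp
    thus "degree (L e) = r" "coeff (L e) r = 1"
      using degree_prod_roots[of "S - {e}" x] fin by (auto simp: L_def)
  qed
  have supp: "{e. c e \<noteq> 0} = S" using L0 by (auto simp: c_def)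
  have "(\<Sum>i<N. c i * x i ^ k) = 0" if k: "k < r" for k
  proof -
    define Q where "Q = (\<Sum>e\<in>S. smult (c e * x e ^ k) (L e))"
    have "poly (Q - monom 1 k) (x f) = 0" if f: "f \<in> S" for f
    proof -
      have "poly Q (x f) = (\<Sum>e\<in>S. c e * x e ^ k * poly (L e) (x f))"
        by (simp add: Q_def poly_sum)
      also have "\<dots> = (\<Sum>e\<in>{f}. c e * x e ^ k * poly (L e) (x f))"
        by (rule sum.mono_neutral_right) (use f fin L0 in auto)
      also have "\<dots> = x f ^ k" using f L0[of f f] by (simp add: c_def)
      finally show ?thesis by (simp add: poly_monom)
    qed
    hence roots: "x ` S \<subseteq> {y. poly (Q - monom 1 k) y = 0}" by auto
    have degQ: "degree (Q - monom 1 k) \<le> r"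
      unfolding Q_def using k degL
      by (intro degree_diff_le degree_sum_le[OF fin]) (auto intro: order_trans[OF degree_smult_le] simp: degree_monom_eq)
    have "Q - monom 1 k = 0"
    proof (rule ccontr)
      assume nz: "Q - monom 1 k \<noteq> 0"
      have "card (x ` S) = Suc r"
        using card card_image[of x S] x SN by (metis inj_on_subset)
      hence "Suc r \<le> card {y. poly (Q - monom 1 k) y = 0}"
        using card_mono[OF poly_roots_finite[OF nz] roots] by simp
      thus False using card_poly_roots_bound[OF nz] degQ by simp
    qed
    hence "coeff Q r = 0" using k by (metis coeff_monom eq_iff_diff_eq_0 less_irrefl)
    hence "(\<Sum>e\<in>S. c e * x e ^ k) = 0" using degL by (simp add: Q_def coeff_sum)
    moreover have "(\<Sum>i<N. c i * x i ^ k) = (\<Sum>e\<in>S. c e * x e ^ k)"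
      by (rule sum.mono_neutral_right) (use SN in \<open>auto simp: c_def\<close>)
    ultimately show ?thesis by simp
  qed
  moreover have "c e = 0" if "e \<notin> {..<N}" for e using that SN by (auto simp: c_def)
  ultimately have "lin_dependence {..<N} r (\<lambda>i k. x i ^ k) c" by (auto simp: lin_dependence_def)
  with supp show ?thesis using that by blast
qed

lemma dependence_alternates:
  fixes x :: "nat \<Rightarrow> real"
  assumes dep: "lin_dependence {..<N} r (\<lambda>i k. x i ^ k) c" and x: "strict_mono_on {..<N} x"
    and card: "card {e. c e \<noteq> 0} = Suc r"
  shows "alternates ({e. c e > 0}, {e. c e < 0})"
proof -
  define S where "S = {e. c e \<noteq> 0}"
  have supp: "supp ({e. c e > 0}, {e. c e < 0}) = S" by (auto simp: supp_def S_def)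
  have SN: "S \<subseteq> {..<N}" using dep by (auto simp: S_def lin_dependence_def)
  hence fin: "finite S" by (rule finite_subset) simp
  have less: "x a < x b" if "a \<in> S" "b \<in> S" "a < b" for a b
    using x SN that by (auto simp: strict_mono_on_def)
  have "c i > 0 \<longleftrightarrow> c j < 0" if ij: "i \<in> S" "j \<in> S" "i < j" "{i<..<j} \<inter> S = {}" for i j
  proof -
    define p where "p = (\<Prod>f\<in>S - {i, j}. [:- x f, 1:])"
    have c2: "card {i, j} = 2" "card {i, j} \<le> card S"
      using ij card_mono[OF fin, of "{i, j}"] by simp_all
    hence "card (S - {i, j}) = Suc r - 2" "Suc r \<ge> 2" using ij fin card
      by (auto simp: card_Diff_subset S_def)
    hence "degree p < r" using fin by (simp add: p_def degree_prod_roots)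
    hence "0 = (\<Sum>e<N. c e * poly p (x e))" using dependence_poly[OF dep] by simp
    also have "\<dots> = (\<Sum>e\<in>{i, j}. c e * poly p (x e))"
    proof (rule sum.mono_neutral_right)
      show "\<forall>e\<in>{..<N} - {i, j}. c e * poly p (x e) = 0"
        using fin by (auto simp: p_def poly_prod S_def)
    qed (use ij SN in auto)
    finally have eq: "c i * poly p (x i) + c j * poly p (x j) = 0" using ij by simp
    have "0 < poly p (x i) * poly p (x j)"
    proof -
      have "0 < (\<Prod>f\<in>S - {i, j}. (x i - x f) * (x j - x f))"
      proof (rule prod_pos)
        fix f assume f: "f \<in> S - {i, j}"
        hence "f < i \<or> j < f" using ij by (metis Diff_iff disjoint_iff greaterThanLessThan_iff insertCI linorder_neqE_nat)
        thus "0 < (x i - x f) * (x j - x f)"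
          using less[of f i] less[of f j] less[of i f] less[of j f] f ij
          by (auto intro: mult_pos_pos mult_neg_neg)
      qed
      thus ?thesis by (simp add: p_def poly_prod prod.distrib)
    qed
    hence same: "poly p (x i) > 0 \<and> poly p (x j) > 0 \<or> poly p (x i) < 0 \<and> poly p (x j) < 0"
      by (simp add: zero_less_mult_iff)
    have nz: "c i \<noteq> 0" "c j \<noteq> 0" using ij by (auto simp: S_def)
    have "c i * poly p (x i) = - (c j * poly p (x j))" using eq by simp
    hence "c i * poly p (x i) > 0 \<longleftrightarrow> c j * poly p (x j) < 0" by simp
    thus ?thesis using same nz unfolding zero_less_mult_iff mult_less_0_iff by linarith
  qed
  thus ?thesis unfolding alternates_def supp by auto
qed

lemma alternates_unique:
  fixes C D :: "nat signed_set"
  assumes C: "alternates C" and D: "alternates D" and S: "supp C = supp D" "finite (supp C)"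
  shows "C = D \<or> C = opposite D"
proof (cases "supp C = {}")
  case True
  thus ?thesis using S by (auto simp: supp_def prod_eq_iff)
next
  case False
  have "fst C \<inter> snd C = {}" "fst D \<inter> snd D = {}" using C D unfolding alternates_def by blast+
  hence disj: "snd C = supp C - fst C" "snd D = supp C - fst D"
      "fst C \<subseteq> supp C" "fst D \<subseteq> supp C"
    using S(1) unfolding supp_def by blast+
  define a where "a = Min (supp C)"
  have aS: "a \<in> supp C" and amin: "\<And>j. j \<in> supp C \<Longrightarrow> a \<le> j"
    using False S by (auto simp: a_def)
  have step: "(j \<in> fst C \<longleftrightarrow> j \<in> fst D) \<longleftrightarrow> (a \<in> fst C \<longleftrightarrow> a \<in> fst D)" if "j \<in> supp C" for j
    using that
  proof (induction j rule: less_induct)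
    case (less j)
    show ?case
    proof (cases "j = a")
      case False
      define i where "i = Max {i \<in> supp C. i < j}"
      have ne: "{i \<in> supp C. i < j} \<noteq> {}" "finite {i \<in> supp C. i < j}"
        using False aS amin[OF less.prems] S by auto
      have i: "i \<in> supp C" "i < j" using Max_in[OF ne(2,1)] by (auto simp: i_def)
      have gap: "{i<..<j} \<inter> supp C = {}"
      proof -
        have "k \<le> i" if "k \<in> supp C" "k < j" for k
          unfolding i_def by (rule Max_ge[OF ne(2)]) (use that in simp)
        thus ?thesis by fastforce
      qed
      have "i \<in> fst C \<longleftrightarrow> j \<in> snd C" using C i gap less.prems by (auto simp: alternates_def)
      moreover have "i \<in> fst D \<longleftrightarrow> j \<in> snd D"
        using D i gap less.prems S by (auto simp: alternates_def)
      moreover have "j \<in> snd C \<longleftrightarrow> j \<notin> fst C" "j \<in> snd D \<longleftrightarrow> j \<notin> fst D"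
        using disj less.prems by blast+
      ultimately show ?thesis using less.IH[OF i(2,1)] by blast
    qed simp
  qed
  show ?thesis
  proof (cases "a \<in> fst C \<longleftrightarrow> a \<in> fst D")
    case True
    hence "fst C = fst D" using step disj by blast
    thus ?thesis using disj by (simp add: prod_eq_iff)
  next
    case False
    hence "fst C = snd D" "snd C = fst D" using step disj by blast+
    thus ?thesis by (simp add: opposite_def prod_eq_iff)
  qed
qed

lemma vector_circuits_moment_curve:
  fixes x :: "nat \<Rightarrow> real"
  assumes x: "strict_mono_on {..<N} x"
  shows "vector_circuits {..<N} r (\<lambda>i k. x i ^ k) =
         {C. supp C \<subseteq> {..<N} \<and> card (supp C) = Suc r \<and> alternates C}" (is "?L = ?R")
proof (intro equalityI subsetI)
  have inj: "inj_on x {..<N}" using x by (rule strict_mono_on_imp_inj_on)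
  let ?dep = "lin_dependence {..<N} r (\<lambda>i k. x i ^ k)"
  let ?sg = "\<lambda>c :: nat \<Rightarrow> real. ({e. c e > 0}, {e. c e < 0})"
  have supp: "supp (?sg c) = {e. c e \<noteq> 0}" for c by (auto simp: supp_def)
  {
    fix C assume "C \<in> ?L"
    then obtain c where c: "C = ?sg c" "?dep c" "\<exists>e. c e \<noteq> 0"
      and minim: "\<And>c'. ?dep c' \<Longrightarrow> (\<exists>e. c' e \<noteq> 0) \<Longrightarrow> {e. c' e \<noteq> 0} \<subseteq> {e. c e \<noteq> 0} \<Longrightarrow>
        {e. c' e \<noteq> 0} = {e. c e \<noteq> 0}"
      unfolding vector_circuits_def by blast
    have SN: "{e. c e \<noteq> 0} \<subseteq> {..<N}" using c(2) by (auto simp: lin_dependence_def)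
    have "Suc r \<le> card {e. c e \<noteq> 0}" using dependence_support_card[OF c(2) inj] c(3) by (blast intro: Suc_leI)
    then obtain T where T: "T \<subseteq> {e. c e \<noteq> 0}" "card T = Suc r"
      by (metis obtain_subset_with_card_n)
    then obtain c' where c': "?dep c'" "{e. c' e \<noteq> 0} = T"
      using dependence_exists[OF inj, of T r] SN by blast
    have "T \<noteq> {}" using T by auto
    hence "T = {e. c e \<noteq> 0}" using minim[OF c'(1)] c'(2) T by blast
    hence card: "card {e. c e \<noteq> 0} = Suc r" using T by simp
    show "C \<in> ?R" using dependence_alternates[OF c(2) x card] card SN c(1) supp by auto
  next
    fix C assume "C \<in> ?R"
    hence C: "supp C \<subseteq> {..<N}" "card (supp C) = Suc r" "alternates C" by auto
    obtain c where c: "?dep c" "{e. c e \<noteq> 0} = supp C"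
      using dependence_exists[OF inj C(1,2)] by blast
    have inL: "?sg d \<in> ?L" if d: "?dep d" "{e. d e \<noteq> 0} = supp C" for d
    proof -
      have "supp C \<noteq> {}" using C(2) by auto
      hence "\<exists>e. d e \<noteq> 0" using d(2) by blast
      moreover have "{e. c' e \<noteq> 0} = {e. d e \<noteq> 0}"
        if c': "?dep c'" "\<exists>e. c' e \<noteq> 0" "{e. c' e \<noteq> 0} \<subseteq> {e. d e \<noteq> 0}" for c'
      proof (rule card_seteq[OF _ c'(3)])
        show "finite {e. d e \<noteq> 0}" using d(2) C(1) finite_subset by auto
        show "card {e. d e \<noteq> 0} \<le> card {e. c' e \<noteq> 0}"
          unfolding d(2) C(2) using dependence_support_card[OF c'(1) inj] c'(2) by (blast intro: Suc_leI)
      qed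
      ultimately show ?thesis unfolding vector_circuits_def using d(1) by blast
    qed
    have "alternates (?sg c)" using dependence_alternates[OF c(1) x] c(2) C(2) by simp
    moreover have "supp C = supp (?sg c)" using c(2) by (simp add: supp)
    moreover have "finite (supp C)" using C(1) finite_subset by auto
    ultimately have "C = ?sg c \<or> C = opposite (?sg c)" using alternates_unique[OF C(3)] by blast
    moreover have "?sg c \<in> ?L" using inL c by blast
    moreover have "opposite (?sg c) \<in> ?L"
    proof -
      have "?dep (\<lambda>e. - c e)" using c(1) by (auto simp: lin_dependence_def sum_negf)
      moreover have "{e. - c e \<noteq> 0} = supp C" using c(2) by simp
      ultimately have "?sg (\<lambda>e. - c e) \<in> ?L" by (rule inL)
      thus ?thesis by (simp add: opposite_def)
    qed
    ultimately show "C \<in> ?L" by (elim disjE) (simp_all only:)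
  }
qed

section \<open>P-matroids and simple extensions\<close>

definition complement :: "nat \<Rightarrow> nat \<Rightarrow> nat" where
  "complement n e = (if e < n then e + n else e - n)"

definition P_matroid :: "nat \<Rightarrow> nat signed_set set \<Rightarrow> bool" where
  "P_matroid n \<C> \<longleftrightarrow>
     oriented_matroid {..<2*n} \<C> \<and>
     om_basis {..<2*n} \<C> {..<n} \<and>
     (\<forall>B. B \<subseteq> {..<2*n} \<and> card B = n \<and> \<not> (\<exists>e\<in>B. complement n e \<in> B) \<longrightarrow> om_basis {..<2*n} \<C> B) \<and>
     \<not> (\<exists>C\<in>\<C>. \<exists>e<2*n. e \<in> fst C \<and> complement n e \<in> snd C \<and>
          (\<forall>f<2*n. f \<in> supp C \<and> complement n f \<in> supp C \<longrightarrow> f = e \<or> f = complement n e))"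

definition cyclic_P_matroid_via ::
    "nat \<Rightarrow> (nat \<Rightarrow> nat) \<Rightarrow> nat set \<Rightarrow> nat signed_set set \<Rightarrow> bool" where
  "cyclic_P_matroid_via n \<pi> F \<C> \<longleftrightarrow>
     P_matroid n \<C> \<and> \<pi> permutes {..<2*n} \<and> F \<subseteq> {..<2*n} \<and>
     relabel \<pi> (reorient F \<C>) = alternating_matroid [0..<2*n] n"

text \<open>The extended ground set ordered with \<open>q\<close> inserted after the first \<open>p\<close> elements of \<open>E\<^sub>2\<^sub>n\<close>;
  hence \<open>q\<close> is the last element of \<open>\<pi>\<close> precisely for \<open>p = 2*n\<close>.\<close>

definition extended_order :: "nat \<Rightarrow> nat \<Rightarrow> nat list" where
  "extended_order n p = [0..<p] @ [2*n] @ [p..<2*n]"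

definition simple_extension_via ::
    "nat \<Rightarrow> nat \<Rightarrow> (nat \<Rightarrow> nat) \<Rightarrow> nat set \<Rightarrow> nat signed_set set \<Rightarrow> bool" where
  "simple_extension_via n p \<pi> F \<C> \<longleftrightarrow>
     oriented_matroid {..2*n} \<C> \<and> p \<le> 2*n \<and>
     \<pi> permutes {..2*n} \<and> \<pi> (2*n) = 2*n \<and> F \<subseteq> {..2*n} \<and>
     relabel \<pi> (reorient F \<C>) = alternating_matroid (extended_order n p) n \<and>
     cyclic_P_matroid_via n \<pi> (F \<inter> {..<2*n}) (restriction \<C> {..<2*n})"

definition associated_USO :: "nat \<Rightarrow> nat signed_set set \<Rightarrow> nat set \<Rightarrow> nat set" where
  "associated_USO n \<C> v =
     (let C = fundamental_circuit \<C> (({..<n} - v) \<union> (\<lambda>i. i + n) ` v) (2*n)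
      in {i. i < n \<and> (i \<in> snd C \<or> i + n \<in> snd C)})"

end

theory Submission
  imports Defs
begin

text \<open>
  Let \<open>E\<close> be the arc relation of the influence graph. The outmap of a Matousek USO at \<open>v\<close> contains \<open>j\<close>
  iff the number of \<open>d \<in> v\<close> with \<open>(d, j) \<in> E\<close> is odd (\<open>matousek_outmap\<close>). Everything below
  compares this parity with signs.

  If the graph contains one of the two forbidden graphs on dimensions \<open>a, b, c\<close>, where the two
  dimensions \<open>a, b\<close> are those that act on others, consider the candidate solutions for the bases
  \<open>{}\<close>, \<open>{a}\<close>, \<open>{b}\<close>, \<open>{a, b}\<close>. They are four points in a plane, hence affinely dependent, and the
  affine functions \<open>w\<^sub>b\<close> and \<open>w\<^sub>c\<close> have prescribed signs on them. These signs contradict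
  the affine dependence (\<open>realizable_imp_no_G1_G2\<close>).

  If neither graph occurs, then \<open>E\<close> is transitive, and the in-neighbours of every vertex form a chain:
  \<open>E\<close> is the ancestor relation of a rooted forest (\<open>forest_order_if_no_G1_G2\<close>). This has two
  consequences.

  First, the outmap is realized by a triangular P-matrix with diagonal entries one and the entry two
  for every strict ancestor, and by the constant right-hand side one. Going down a chain of
  ancestors in the basis, the solution takes the values \<open>1, -1, 1, \<dots>\<close>, whose signs are the wanted
  parities (\<open>forest_imp_realizable\<close>).

  Second, a forest can be written as a sequence of nested brackets, where \<open>i\<close> is the opening and
  \<open>i + n\<close> the closing bracket of node \<open>i\<close> (\<open>layout_permutation_exists\<close>). Take the alternating
  matroid along this sequence with \<open>q\<close> at the end. In the fundamental circuit of \<open>q\<close> over a basis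
  that takes one bracket of each pair, the sign at pair \<open>i\<close> is the parity of the number of
  chosen brackets behind it. Exchanging the brackets of a pair that encloses pair \<open>i\<close> changes this
  number by one; exchanging those of any other pair \<open>j \<noteq> i\<close> leaves it alone. So the enclosing
  pairs act on \<open>i\<close> exactly as the ancestors do, and a reorientation adjusts
  the constants and the effect of pair \<open>i\<close> on itself (\<open>associated_USO_circuits\<close>). The same
  reorientation gives the P-matroid property, since the number of chosen brackets between \<open>i\<close> and
  \<open>i + n\<close> is the number of strict descendants of \<open>i\<close> (\<open>same_sign_on_unique_pair\<close>).
\<close>

section \<open>Induced subgraphs and the shape of the influence graph\<close>

text \<open>Isomorphisms of digraphs also carry a map on arcs. Between graphs whose arcs are pairs of vertices
  that map is determined by the map on vertices, so an induced copy is an injection that preserves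
  and reflects adjacency.\<close>

lemma contains_induced_iff:
  assumes G: "pair_wf_digraph G" and H: "pair_wf_digraph H"
  shows "contains_induced G H \<longleftrightarrow>
    (\<exists>f. inj_on f (pverts H) \<and> f ` pverts H \<subseteq> pverts G \<and>
       (\<forall>a\<in>pverts H. \<forall>b\<in>pverts H. (f a, f b) \<in> parcs G \<longleftrightarrow> (a, b) \<in> parcs H))"
    (is "?L \<longleftrightarrow> ?R")
proof
  assume ?L
  then obtain K g where ind: "induced_subgraph K (with_proj G)"
    and g: "pre_digraph.digraph_isomorphism K g" and app: "with_proj H = app_iso g K"
    unfolding contains_induced_def digraph_iso_def by blast
  have K: "verts K \<subseteq> pverts G" "tail K = fst" "head K = snd"
    "arcs K = {e \<in> parcs G. fst e \<in> verts K \<and> snd e \<in> verts K}"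
    using ind by (auto simp: induced_subgraph_def subgraph_def compatible_def)
  have inj: "inj_on (iso_verts g) (verts K)"
    and ends: "\<And>a. a \<in> arcs K \<Longrightarrow> iso_verts g (fst a) = iso_tail g (iso_arcs g a) \<and>
      iso_verts g (snd a) = iso_head g (iso_arcs g a)"
    using g K unfolding pre_digraph.digraph_isomorphism_def by auto
  have Hv: "pverts H = iso_verts g ` verts K" "parcs H = iso_arcs g ` arcs K"
    and tl: "iso_tail g = fst" "iso_head g = snd"
    using arg_cong[OF app, of verts] arg_cong[OF app, of arcs] arg_cong[OF app, of tail]
      arg_cong[OF app, of head] by (auto simp: app_iso_def)
  define f where "f = the_inv_into (verts K) (iso_verts g)"
  have fg: "f (iso_verts g a) = a" if "a \<in> verts K" for a
    using inj that by (simp add: f_def the_inv_into_f_f)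
  have gf: "iso_verts g (f a) = a" "f a \<in> verts K" if "a \<in> pverts H" for a
    using that Hv(1) fg by auto
  have "(f a, f b) \<in> parcs G \<longleftrightarrow> (a, b) \<in> parcs H" if ab: "a \<in> pverts H" "b \<in> pverts H" for a b
  proof
    assume "(f a, f b) \<in> parcs G"
    hence e: "(f a, f b) \<in> arcs K" using K(4) gf ab by simp
    have "iso_arcs g (f a, f b) = (a, b)" using ends[OF e] tl gf ab by (auto simp: prod_eq_iff)
    thus "(a, b) \<in> parcs H" using e Hv(2) by force
  next
    assume "(a, b) \<in> parcs H"
    then obtain e where e: "e \<in> arcs K" "iso_arcs g e = (a, b)" using Hv(2) by force
    hence "iso_verts g (fst e) = a" "iso_verts g (snd e) = b" using ends[OF e(1)] tl by auto
    hence "e = (f a, f b)" using fg e(1) K(4) by (auto simp: prod_eq_iff)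
    thus "(f a, f b) \<in> parcs G" using e(1) K(4) by simp
  qed
  moreover have "inj_on f (pverts H)" using gf by (metis inj_onI)
  moreover have "f ` pverts H \<subseteq> pverts G" using gf K(1) by auto
  ultimately show ?R by blast
next
  assume ?R
  then obtain f where f: "inj_on f (pverts H)" "f ` pverts H \<subseteq> pverts G"
    and fE: "\<And>a b. a \<in> pverts H \<Longrightarrow> b \<in> pverts H \<Longrightarrow> (f a, f b) \<in> parcs G \<longleftrightarrow> (a, b) \<in> parcs H"
    by blast
  define g where "g = the_inv_into (pverts H) f"
  have gf: "g (f a) = a" if "a \<in> pverts H" for a
    using f(1) that by (simp add: g_def the_inv_into_f_f)
  define K where "K = with_proj \<lparr> pverts = f ` pverts H, parcs = map_prod f f ` parcs H \<rparr>"
  have HE: "a \<in> pverts H" "b \<in> pverts H" if "(a, b) \<in> parcs H" for a b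
    using that pair_wf_digraph.in_arcsD1[OF H] pair_wf_digraph.in_arcsD2[OF H] by blast+
  have wf: "wf_digraph K" "wf_digraph (with_proj G)"
    by (rule wf_digraph.intro; use pair_wf_digraph.in_arcsD1[OF G] pair_wf_digraph.in_arcsD2[OF G] in
        \<open>auto simp: K_def dest: HE\<close>)+
  have arcs: "map_prod f f ` parcs H = {e \<in> parcs G. fst e \<in> f ` pverts H \<and> snd e \<in> f ` pverts H}"
    using HE fE by (auto intro!: image_eqI)
  have "subgraph K (with_proj G)"
    unfolding subgraph_def compatible_def using wf f(2) arcs by (auto simp: K_def)
  hence "induced_subgraph K (with_proj G)"
    unfolding induced_subgraph_def using arcs by (simp add: K_def)
  moreover
  let ?h = "\<lparr> iso_verts = g, iso_arcs = map_prod g g, iso_head = snd, iso_tail = fst \<rparr>"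
  have "pre_digraph.digraph_isomorphism K ?h"
  proof -
    have "inj_on g (f ` pverts H)" using gf by (auto simp: inj_on_def)
    moreover have "inj_on (map_prod g g) (map_prod f f ` parcs H)"
      using gf HE by (auto simp: inj_on_def)
    ultimately show ?thesis
      unfolding pre_digraph.digraph_isomorphism_def using wf(1) by (auto simp: K_def)
  qed
  moreover have "with_proj H = app_iso ?h K"
  proof -
    have "g ` f ` pverts H = pverts H" by (simp add: image_image gf)
    moreover have "map_prod g g (map_prod f f e) = e" if "e \<in> parcs H" for e
      using that HE by (cases e) (auto simp: gf)
    hence "map_prod g g ` map_prod f f ` parcs H = parcs H" by (simp add: image_image)
    ultimately show ?thesis by (simp add: K_def app_iso_def with_proj_def)
  qed
  ultimately show ?L unfolding contains_induced_def digraph_iso_def by blast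
qed

lemma wf_graph_G1: "pair_wf_digraph graph_G1" and wf_graph_G2: "pair_wf_digraph graph_G2"
  unfolding pair_wf_digraph_def graph_G1_def graph_G2_def by auto

lemma contains_induced_G1_iff:
  assumes "pair_wf_digraph G" "\<forall>d\<in>pverts G. (d, d) \<in> parcs G"
  shows "contains_induced G graph_G1 \<longleftrightarrow>
    (\<exists>x y z. distinct [x, y, z] \<and> {x, y, z} \<subseteq> pverts G \<and>
      (x, y) \<in> parcs G \<and> (y, z) \<in> parcs G \<and> (x, z) \<notin> parcs G \<and>
      (y, x) \<notin> parcs G \<and> (z, y) \<notin> parcs G \<and> (z, x) \<notin> parcs G)" (is "_ \<longleftrightarrow> ?R")
proof
  assume "contains_induced G graph_G1"
  then obtain f :: "nat \<Rightarrow> 'a" where "inj_on f {0,1,2}" "f ` {0,1,2} \<subseteq> pverts G"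
    "\<forall>a\<in>{0,1,2}. \<forall>b\<in>{0,1,2}. (f a, f b) \<in> parcs G \<longleftrightarrow> (a, b) \<in> parcs graph_G1"
    unfolding contains_induced_iff[OF assms(1) wf_graph_G1] by (auto simp: graph_G1_def)
  hence "distinct [f 0, f 1, f 2] \<and> {f 0, f 1, f 2} \<subseteq> pverts G \<and>
      (f 0, f 1) \<in> parcs G \<and> (f 1, f 2) \<in> parcs G \<and> (f 0, f 2) \<notin> parcs G \<and>
      (f 1, f 0) \<notin> parcs G \<and> (f 2, f 1) \<notin> parcs G \<and> (f 2, f 0) \<notin> parcs G"
    by (auto simp: graph_G1_def)
  thus ?R by blast
next
  assume ?R
  then obtain x y z where *: "distinct [x, y, z]" "{x, y, z} \<subseteq> pverts G"
      "(x, y) \<in> parcs G" "(y, z) \<in> parcs G" "(x, z) \<notin> parcs G"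
      "(y, x) \<notin> parcs G" "(z, y) \<notin> parcs G" "(z, x) \<notin> parcs G" by blast
  show "contains_induced G graph_G1"
    unfolding contains_induced_iff[OF assms(1) wf_graph_G1]
    by (rule exI[of _ "\<lambda>i. if i = (0::nat) then x else if i = 1 then y else z"])
       (use * assms(2) in \<open>auto simp: graph_G1_def inj_on_def\<close>)
qed

lemma contains_induced_G2_iff:
  assumes "pair_wf_digraph G" "\<forall>d\<in>pverts G. (d, d) \<in> parcs G"
  shows "contains_induced G graph_G2 \<longleftrightarrow>
    (\<exists>x y z. distinct [x, y, z] \<and> {x, y, z} \<subseteq> pverts G \<and>
      (x, z) \<in> parcs G \<and> (y, z) \<in> parcs G \<and> (x, y) \<notin> parcs G \<and>
      (y, x) \<notin> parcs G \<and> (z, y) \<notin> parcs G \<and> (z, x) \<notin> parcs G)" (is "_ \<longleftrightarrow> ?R")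
proof
  assume "contains_induced G graph_G2"
  then obtain f :: "nat \<Rightarrow> 'a" where "inj_on f {0,1,2}" "f ` {0,1,2} \<subseteq> pverts G"
    "\<forall>a\<in>{0,1,2}. \<forall>b\<in>{0,1,2}. (f a, f b) \<in> parcs G \<longleftrightarrow> (a, b) \<in> parcs graph_G2"
    unfolding contains_induced_iff[OF assms(1) wf_graph_G2] by (auto simp: graph_G2_def)
  hence "distinct [f 0, f 1, f 2] \<and> {f 0, f 1, f 2} \<subseteq> pverts G \<and>
      (f 0, f 2) \<in> parcs G \<and> (f 1, f 2) \<in> parcs G \<and> (f 0, f 1) \<notin> parcs G \<and>
      (f 1, f 0) \<notin> parcs G \<and> (f 2, f 1) \<notin> parcs G \<and> (f 2, f 0) \<notin> parcs G"
    by (auto simp: graph_G2_def)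
  thus ?R by blast
next
  assume ?R
  then obtain x y z where *: "distinct [x, y, z]" "{x, y, z} \<subseteq> pverts G"
      "(x, z) \<in> parcs G" "(y, z) \<in> parcs G" "(x, y) \<notin> parcs G"
      "(y, x) \<notin> parcs G" "(z, y) \<notin> parcs G" "(z, x) \<notin> parcs G" by blast
  show "contains_induced G graph_G2"
    unfolding contains_induced_iff[OF assms(1) wf_graph_G2]
    by (rule exI[of _ "\<lambda>i. if i = (0::nat) then x else if i = 1 then y else z"])
       (use * assms(2) in \<open>auto simp: graph_G2_def inj_on_def\<close>)
qed

text \<open>The graphs that remain once both subgraphs are excluded: \<open>E\<close> is the ancestor relation of a
  rooted forest, reflexive because of the loops, and an arc leads from ancestor to descendant.\<close>

definition forest_order :: "nat \<Rightarrow> (nat \<times> nat) set \<Rightarrow> bool" where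
  "forest_order n E \<longleftrightarrow> E \<subseteq> {..<n} \<times> {..<n} \<and> (\<forall>i<n. (i, i) \<in> E) \<and> trans E \<and> antisym E \<and>
     (\<forall>i j k. (i, k) \<in> E \<longrightarrow> (j, k) \<in> E \<longrightarrow> (i, j) \<in> E \<or> (j, i) \<in> E)"

lemma forest_orderD:
  assumes "forest_order n E"
  shows "(i, j) \<in> E \<Longrightarrow> i < n" "(i, j) \<in> E \<Longrightarrow> j < n" "i < n \<Longrightarrow> (i, i) \<in> E"
    "(i, j) \<in> E \<Longrightarrow> (j, k) \<in> E \<Longrightarrow> (i, k) \<in> E" "(i, j) \<in> E \<Longrightarrow> (j, i) \<in> E \<Longrightarrow> i = j"
    "(i, k) \<in> E \<Longrightarrow> (j, k) \<in> E \<Longrightarrow> (i, j) \<in> E \<or> (j, i) \<in> E"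
  using assms unfolding forest_order_def antisym_def by (auto dest: transD)

text \<open>Acyclicity is put to use through the directed cycles of length two and three, since the forest
  order is a condition on three vertices at a time.\<close>

lemma dimension_influence_graphD:
  assumes "dimension_influence_graph n G"
  shows "pair_wf_digraph G" "pverts G = {..<n}" "parcs G \<subseteq> {..<n} \<times> {..<n}"
    "d < n \<Longrightarrow> (d, d) \<in> parcs G"
    "(x, y) \<in> parcs G \<Longrightarrow> (y, x) \<in> parcs G \<Longrightarrow> x = y"
    "(x, y) \<in> parcs G \<Longrightarrow> (y, z) \<in> parcs G \<Longrightarrow> (z, x) \<in> parcs G \<Longrightarrow> x = y"
proof -
  show wf: "pair_wf_digraph G" and V: "pverts G = {..<n}"
    and "d < n \<Longrightarrow> (d, d) \<in> parcs G"
    using assms by (auto simp: dimension_influence_graph_def)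
  interpret pair_wf_digraph G by (rule wf)
  show "parcs G \<subseteq> {..<n} \<times> {..<n}" using V in_arcsD1 in_arcsD2 by auto
  have cyc: "\<exists>d. p = [(d, d)]" if "cycle p" for p
    using that assms by (auto simp: dimension_influence_graph_def)
  show two: "x = y" if "(x, y) \<in> parcs G" "(y, x) \<in> parcs G" for x y
  proof (rule ccontr)
    assume "x \<noteq> y"
    hence "cycle [(x, y), (y, x)]" unfolding cycle_def
      using that in_arcsD1 by (auto simp: awalk_def)
    thus False using cyc by blast
  qed
  show "x = y" if a: "(x, y) \<in> parcs G" "(y, z) \<in> parcs G" "(z, x) \<in> parcs G"
  proof (rule ccontr)
    assume "x \<noteq> y"
    hence "distinct [x, y, z]" using two a by auto
    hence "cycle [(x, y), (y, z), (z, x)]" unfolding cycle_def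
      using a in_arcsD1 by (auto simp: awalk_def)
    thus False using cyc by blast
  qed
qed

text \<open>A missing transitive arc over a path \<open>x \<rightarrow> y \<rightarrow> z\<close> produces the first graph, since an arc
  backwards would close a cycle. Two incomparable in-neighbours of a vertex produce the second
  one.\<close>

lemma forest_order_if_no_G1_G2:
  assumes dig: "dimension_influence_graph n G"
    and G1: "\<not> contains_induced G graph_G1" and G2: "\<not> contains_induced G graph_G2"
  shows "forest_order n (parcs G)"
proof -
  note D = dimension_influence_graphD[OF dig]
  have V: "\<forall>d\<in>pverts G. (d, d) \<in> parcs G" using D(2,4) by simp
  have G1': False if "distinct [x, y, z]" "{x, y, z} \<subseteq> pverts G"
      "(x, y) \<in> parcs G" "(y, z) \<in> parcs G" "(x, z) \<notin> parcs G"
      "(y, x) \<notin> parcs G" "(z, y) \<notin> parcs G" "(z, x) \<notin> parcs G" for x y z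
    using contains_induced_G1_iff[OF D(1) V] G1 that by blast
  have G2': False if "distinct [x, y, z]" "{x, y, z} \<subseteq> pverts G"
      "(x, z) \<in> parcs G" "(y, z) \<in> parcs G" "(x, y) \<notin> parcs G"
      "(y, x) \<notin> parcs G" "(z, y) \<notin> parcs G" "(z, x) \<notin> parcs G" for x y z
    using contains_induced_G2_iff[OF D(1) V] G2 that by blast
  have in_V: "x \<in> pverts G" "y \<in> pverts G" if "(x, y) \<in> parcs G" for x y
    using that D(2,3) by auto
  have tr: "(x, z) \<in> parcs G" if a: "(x, y) \<in> parcs G" "(y, z) \<in> parcs G" for x y z
  proof (rule ccontr)
    assume n: "(x, z) \<notin> parcs G"
    have "x \<noteq> y" "y \<noteq> z" "x \<noteq> z" using a n D(5)[OF a(1)] by auto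
    hence "distinct [x, y, z]" "{x, y, z} \<subseteq> pverts G" using a in_V by auto
    moreover have "(y, x) \<notin> parcs G" "(z, y) \<notin> parcs G" "(z, x) \<notin> parcs G"
      using D(5,6) a \<open>x \<noteq> y\<close> \<open>y \<noteq> z\<close> by blast+
    ultimately show False using G1'[of x y z] a n by blast
  qed
  have ch: "(x, y) \<in> parcs G \<or> (y, x) \<in> parcs G" if a: "(x, z) \<in> parcs G" "(y, z) \<in> parcs G" for x y z
  proof (rule ccontr)
    assume n: "\<not> ?thesis"
    have "x \<noteq> y" using n a in_V D(2,4) by auto
    moreover have "x \<noteq> z" "y \<noteq> z" using n a by auto
    ultimately have "distinct [x, y, z]" "{x, y, z} \<subseteq> pverts G" using a in_V by auto
    moreover have "(z, y) \<notin> parcs G" "(z, x) \<notin> parcs G"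
      using D(5) a \<open>x \<noteq> z\<close> \<open>y \<noteq> z\<close> by blast+
    ultimately show False using G2'[of x y z] a n by blast
  qed
  show ?thesis unfolding forest_order_def
    using D(3,4,5) tr ch by (auto simp: trans_def antisym_def)
qed

section \<open>Outmaps of Matousek USOs\<close>

text \<open>Adding one dimension \<open>d\<close> to the vertex flips exactly the out-neighbours of \<open>d\<close>, and the empty
  set is the sink; so the outmap is linear over the field with two elements, with the adjacency
  matrix of the graph as its matrix.\<close>

lemma matousek_outmap:
  assumes m: "matousek_USO n G m" and v: "v \<subseteq> {..<n}"
  shows "m v = {j. j < n \<and> odd (card {d \<in> v. (d, j) \<in> parcs G})}"
proof -
  have "finite v" using v finite_subset by blast
  thus ?thesis using v
  proof (induction v)
    case empty
    thus ?case using m by (simp add: matousek_USO_def)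
  next
    case (insert d v)
    have sub: "m (insert d v) \<subseteq> {..<n}"
      using m insert.prems by (auto simp: matousek_USO_def orientation_def)
    have "sym_diff v {d} = insert d v" using insert.hyps by auto
    moreover have "\<forall>j<n. (j \<in> m v) \<noteq> (j \<in> m (sym_diff v {d})) \<longleftrightarrow> (d, j) \<in> parcs G"
      using m insert.prems by (auto simp: matousek_USO_def)
    ultimately have flip: "(j \<in> m v) \<noteq> (j \<in> m (insert d v)) \<longleftrightarrow> (d, j) \<in> parcs G" if "j < n" for j
      using that by metis
    have "card {e \<in> insert d v. (e, j) \<in> parcs G} =
        (if (d, j) \<in> parcs G then 1 else 0) + card {e \<in> v. (e, j) \<in> parcs G}" for j
    proof -
      have "{e \<in> insert d v. (e, j) \<in> parcs G} =
          (if (d, j) \<in> parcs G then insert d {e \<in> v. (e, j) \<in> parcs G} else {e \<in> v. (e, j) \<in> parcs G})"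
        by auto
      thus ?thesis using insert.hyps by (simp add: card_insert_if)
    qed
    hence "j \<in> m (insert d v) \<longleftrightarrow> odd (card {e \<in> insert d v. (e, j) \<in> parcs G})" if "j < n" for j
      using insert.IH insert.prems flip[OF that] that by auto
    thus ?case using sub by auto
  qed
qed

text \<open>The matrix of the outmap, restricted to the dimensions of a face, is unitriangular with respect
  to the ancestor order. Hence the outmap is injective on the face, and by counting it is a bijection
  onto the subsets of \<open>D\<close>; in particular the empty set is attained exactly once.\<close>

lemma matousek_USO_on_forest_is_USO:
  assumes m: "matousek_USO n G m" and E: "forest_order n (parcs G)"
  shows "USO n m"
  unfolding USO_def
proof (intro conjI allI impI)
  show "orientation n m" using m by (simp add: matousek_USO_def)
  fix D u assume D: "D \<subseteq> {..<n}" and u: "u \<subseteq> {..<n}"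
  note fo = forest_orderD[OF E]
  have finD: "finite D" using D finite_subset by blast
  have inj: "inj_on (\<lambda>v. m v \<inter> D) (face n D u)"
  proof (rule inj_onI, rule ccontr)
    fix v v' assume v: "v \<in> face n D u" "v' \<in> face n D u" "m v \<inter> D = m v' \<inter> D" "v \<noteq> v'"
    have sub: "v \<subseteq> {..<n}" "v' \<subseteq> {..<n}" "sym_diff v v' \<subseteq> D"
      using v(1,2) by (auto simp: face_def)
    have fin: "finite v" "finite v'" using sub finite_subset by blast+
    \<comment> \<open>Compare the two vertices in a minimal dimension in which they differ.\<close>
    define h where "h j = card {d. (d, j) \<in> parcs G}" for j
    have finh: "finite {d. (d, j) \<in> parcs G}" for j
      by (rule finite_subset[of _ "{..<n}"]) (use fo(1) in auto)
    obtain j where j: "j \<in> sym_diff v v'" and jmin: "\<And>d. d \<in> sym_diff v v' \<Longrightarrow> h j \<le> h d"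
      using v(4) arg_min_nat_lemma[of "\<lambda>x. x \<in> sym_diff v v'" _ h] by blast
    have jn: "j < n" "j \<in> D" using j sub by auto
    have eq: "d \<in> v \<longleftrightarrow> d \<in> v'" if d: "(d, j) \<in> parcs G" "d \<noteq> j" for d
    proof (rule ccontr)
      assume "\<not> ?thesis"
      hence "h j \<le> h d" using jmin by blast
      moreover have "{e. (e, d) \<in> parcs G} \<subset> {e. (e, j) \<in> parcs G}"
        using fo(3)[OF jn(1)] fo(4)[OF _ d(1)] fo(5)[OF d(1)] d by blast
      hence "h d < h j" unfolding h_def by (rule psubset_card_mono[OF finh])
      ultimately show False by simp
    qed
    define R where "R = {d \<in> v. (d, j) \<in> parcs G \<and> d \<noteq> j}"
    have R: "R = {d \<in> v'. (d, j) \<in> parcs G \<and> d \<noteq> j}" using eq by (auto simp: R_def)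
    have finR: "finite R" "j \<notin> R" using fin by (auto simp: R_def)
    have "{d \<in> v. (d, j) \<in> parcs G} = (if j \<in> v then insert j R else R)"
      using fo(3)[OF jn(1)] by (auto simp: R_def)
    moreover have "{d \<in> v'. (d, j) \<in> parcs G} = (if j \<in> v' then insert j R else R)"
      using fo(3)[OF jn(1)] by (auto simp: R)
    ultimately have "odd (card {d \<in> v. (d, j) \<in> parcs G}) \<noteq> odd (card {d \<in> v'. (d, j) \<in> parcs G})"
      using j finR by auto
    hence "(j \<in> m v) \<noteq> (j \<in> m v')" using matousek_outmap[OF m] sub jn by auto
    thus False using v(3) jn(2) by blast
  qed
  have "bij_betw (\<lambda>v. v \<inter> D) (face n D u) (Pow D)"
  proof (rule bij_betwI')
    fix x y assume "x \<in> face n D u" "y \<in> face n D u"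
    thus "(x \<inter> D = y \<inter> D) = (x = y)" unfolding face_def by blast
  next
    fix x assume "x \<in> face n D u" thus "x \<inter> D \<in> Pow D" by simp
  next
    fix y assume "y \<in> Pow D"
    thus "\<exists>x\<in>face n D u. y = x \<inter> D"
      using u D by (intro bexI[of _ "(u - D) \<union> y"]) (auto simp: face_def)
  qed
  hence "card (face n D u) = card (Pow D)" by (rule bij_betw_same_card)
  hence "(\<lambda>v. m v \<inter> D) ` face n D u = Pow D"
    using card_image[OF inj] finD by (intro card_subset_eq) auto
  hence "{} \<in> (\<lambda>v. m v \<inter> D) ` face n D u" by simp
  then obtain v where v: "{} = m v \<inter> D" "v \<in> face n D u" by (rule imageE)
  have "v' = v" if "v' \<in> face n D u" "m v' \<inter> D = {}" for v'
    by (rule inj_onD[OF inj _ that(1) v(2)]) (simp add: that(2) v(1)[symmetric])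
  thus "\<exists>!v. v \<in> face n D u \<and> m v \<inter> D = {}" using v by metis
qed

section \<open>The two forbidden subgraphs\<close>

lemma candidate_solution_at_entry:
  assumes "candidate_solution_at n M q B w z" "M \<in> carrier_mat n n" "i < n"
  shows "w $ i = q $ i + (\<Sum>j<n. M $$ (i, j) * z $ j)"
proof -
  have z: "z \<in> carrier_vec n" "w \<in> carrier_vec n" and e: "w - M *\<^sub>v z = q"
    using assms by (auto simp: candidate_solution_at_def candidate_solution_def)
  have "q $ i = w $ i - (M *\<^sub>v z) $ i" using e z assms by auto
  moreover have "(M *\<^sub>v z) $ i = (\<Sum>j<n. M $$ (i, j) * z $ j)"
    using z(1) assms by (auto simp: scalar_prod_def atLeast0LessThan intro!: sum.cong)
  ultimately show ?thesis by simp
qed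

lemma candidate_solution_at_pair:
  assumes c: "candidate_solution_at n M q B w z" "M \<in> carrier_mat n n" "i < n"
    and B: "B \<subseteq> {a, b}" "a < n" "b < n" "a \<noteq> b"
  shows "w $ i = q $ i + M $$ (i, a) * z $ a + M $$ (i, b) * z $ b"
proof -
  have "z $ j = 0" if "j < n" "j \<notin> {a, b}" for j
    using that B(1) c(1) by (auto simp: candidate_solution_at_def)
  hence "(\<Sum>j<n. M $$ (i, j) * z $ j) = (\<Sum>j\<in>{a, b}. M $$ (i, j) * z $ j)"
    by (intro sum.mono_neutral_right) (use B in auto)
  thus ?thesis using candidate_solution_at_entry[OF c] B by simp
qed

text \<open>In the plane of the variables \<open>z\<^sub>a\<close> and \<open>z\<^sub>b\<close> consider the candidate solutions for the bases
  \<open>{}\<close>, \<open>{a}\<close>, \<open>{b}\<close> and \<open>{a, b}\<close>, that is, the points \<open>(0, 0)\<close>, \<open>(s, 0)\<close>, \<open>(0, t)\<close> and \<open>(u, v)\<close>.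
  The last one is the affine combination of the others with the coefficients \<open>\<mu> = 1 - u/s - v/t\<close>,
  \<open>u/s\<close> and \<open>v/t\<close>, and each \<open>w\<^sub>i\<close> is an affine function on this plane. The two equations
  evaluate \<open>w\<^sub>b\<close>, which vanishes at the third and the fourth point, and \<open>w\<^sub>c\<close>.\<close>

lemma affine_dependence_of_bases:
  fixes qb qc :: real
  assumes "qb + Mbb * t = 0" "qb + Mba * u + Mbb * v = 0" "s \<noteq> 0" "t \<noteq> 0"
  obtains \<mu> where
    "\<mu> * qb + (u / s) * (qb + Mba * s) = 0"
    "qc + Mca * u + Mcb * v = \<mu> * qc + (u / s) * (qc + Mca * s) + (v / t) * (qc + Mcb * t)"
proof (rule that[of "1 - u / s - v / t"])
  have qb: "qb = - (Mbb * t)" using assms(1) by simp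
  have "(v / t) * qb = - (Mbb * v)" unfolding qb using assms(4) by simp
  moreover have "(u / s) * (qb + Mba * s) = (u / s) * qb + Mba * u"
    using assms(3) by (simp add: distrib_left)
  ultimately show "(1 - u / s - v / t) * qb + (u / s) * (qb + Mba * s) = 0"
    using assms(2) by (simp add: left_diff_distrib)
  have "(u / s) * (qc + Mca * s) = (u / s) * qc + Mca * u"
    "(v / t) * (qc + Mcb * t) = (v / t) * qc + Mcb * v"
    using assms(3,4) by (simp_all add: distrib_left)
  thus "qc + Mca * u + Mcb * v =
      (1 - u / s - v / t) * qc + (u / s) * (qc + Mca * s) + (v / t) * (qc + Mcb * t)"
    by (simp add: left_diff_distrib)
qed

text \<open>Nondegeneracy makes the weak inequalities of the outmap strict.\<close>

lemma realizes_sign: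
  assumes nd: "nondegenerate n M q" and r: "realizes n M q out" and B: "B \<subseteq> {..<n}"
  obtains w z where "candidate_solution_at n M q B w z"
    "\<And>i. i < n \<Longrightarrow> i \<notin> B \<Longrightarrow> z $ i = 0 \<and> (if i \<in> out B then w $ i < 0 else w $ i > 0)"
    "\<And>i. i < n \<Longrightarrow> i \<in> B \<Longrightarrow> w $ i = 0 \<and> (if i \<in> out B then z $ i < 0 else z $ i > 0)"
proof -
  obtain w z where wz: "candidate_solution_at n M q B w z" "out B = {i. i < n \<and> w $ i \<le> 0 \<and> z $ i \<le> 0}"
    using r B unfolding realizes_def by blast
  have nz: "\<not> (w $ i = 0 \<and> z $ i = 0)" if "i < n" for i
    using nd B wz(1) that unfolding nondegenerate_def by blast
  have bas: "\<And>i. i < n \<Longrightarrow> (i \<in> B \<longrightarrow> w $ i = 0) \<and> (i \<notin> B \<longrightarrow> z $ i = 0)"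
    using wz(1) by (simp add: candidate_solution_at_def)
  show ?thesis
    using that[OF wz(1)] bas nz wz(2) by fastforce
qed

text \<open>The affine dependence together with what the outmap says about its ingredients. Here \<open>\<alpha>\<close> and
  \<open>\<beta>\<close> are the quotients \<open>u/s\<close> and \<open>v/t\<close>, whose denominators are negative because the edges at
  the origin in the directions \<open>a\<close> and \<open>b\<close> point towards the origin.\<close>

lemma signs_at_four_bases:
  assumes M: "M \<in> carrier_mat n n" and nd: "nondegenerate n M q" and r: "realizes n M q out"
    and abc: "a < n" "b < n" "c < n" "distinct [a, b, c]"
    and e: "out {} = {}" and ab: "a \<in> out {a}" "b \<in> out {b}"
  obtains \<mu> \<alpha> \<beta> qb qc wba wca wcb wc :: real where
    "qb > 0" "qc > 0"
    "if a \<in> out {a, b} then \<alpha> > 0 else \<alpha> < 0"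
    "if b \<in> out {a, b} then \<beta> > 0 else \<beta> < 0"
    "if b \<in> out {a} then wba < 0 else wba > 0"
    "if c \<in> out {a} then wca < 0 else wca > 0"
    "if c \<in> out {b} then wcb < 0 else wcb > 0"
    "if c \<in> out {a, b} then wc < 0 else wc > 0"
    "\<mu> * qb + \<alpha> * wba = 0" "wc = \<mu> * qc + \<alpha> * wca + \<beta> * wcb"
proof -
  have sub: "{} \<subseteq> {..<n}" "{a} \<subseteq> {..<n}" "{b} \<subseteq> {..<n}" "{a, b} \<subseteq> {..<n}"
    using abc by auto
  have ne: "a \<noteq> b" "a \<noteq> c" "b \<noteq> c" using abc by auto
  obtain w0 z0 where 0: "candidate_solution_at n M q {} w0 z0"
    "\<And>i. i < n \<Longrightarrow> i \<notin> {} \<Longrightarrow> z0 $ i = 0 \<and> (if i \<in> out {} then w0 $ i < 0 else w0 $ i > 0)"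
    by (rule realizes_sign[OF nd r sub(1)]) blast
  obtain w1 z1 where 1: "candidate_solution_at n M q {a} w1 z1"
    "\<And>i. i < n \<Longrightarrow> i \<notin> {a} \<Longrightarrow> z1 $ i = 0 \<and> (if i \<in> out {a} then w1 $ i < 0 else w1 $ i > 0)"
    "\<And>i. i < n \<Longrightarrow> i \<in> {a} \<Longrightarrow> w1 $ i = 0 \<and> (if i \<in> out {a} then z1 $ i < 0 else z1 $ i > 0)"
    by (rule realizes_sign[OF nd r sub(2)]) blast
  obtain w2 z2 where 2: "candidate_solution_at n M q {b} w2 z2"
    "\<And>i. i < n \<Longrightarrow> i \<notin> {b} \<Longrightarrow> z2 $ i = 0 \<and> (if i \<in> out {b} then w2 $ i < 0 else w2 $ i > 0)"
    "\<And>i. i < n \<Longrightarrow> i \<in> {b} \<Longrightarrow> w2 $ i = 0 \<and> (if i \<in> out {b} then z2 $ i < 0 else z2 $ i > 0)"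
    by (rule realizes_sign[OF nd r sub(3)]) blast
  obtain w3 z3 where 3: "candidate_solution_at n M q {a, b} w3 z3"
    "\<And>i. i < n \<Longrightarrow> i \<notin> {a, b} \<Longrightarrow> z3 $ i = 0 \<and> (if i \<in> out {a, b} then w3 $ i < 0 else w3 $ i > 0)"
    "\<And>i. i < n \<Longrightarrow> i \<in> {a, b} \<Longrightarrow> w3 $ i = 0 \<and> (if i \<in> out {a, b} then z3 $ i < 0 else z3 $ i > 0)"
    by (rule realizes_sign[OF nd r sub(4)]) blast
  note row = candidate_solution_at_pair[OF _ M _ _ abc(1,2) ne(1)]
  have w0: "w0 $ i = q $ i" if "i < n" for i
    using row[OF 0(1) that] 0(2)[OF abc(1)] 0(2)[OF abc(2)] by simp
  hence q: "q $ i > 0" if "i < n" for i using 0(2)[OF that] e that by simp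
  have w1: "w1 $ i = q $ i + M $$ (i, a) * z1 $ a" if "i < n" for i
    using row[OF 1(1) that] 1(2)[OF abc(2)] ne by simp
  have w2: "w2 $ i = q $ i + M $$ (i, b) * z2 $ b" if "i < n" for i
    using row[OF 2(1) that] 2(2)[OF abc(1)] ne by simp
  have w3: "w3 $ i = q $ i + M $$ (i, a) * z3 $ a + M $$ (i, b) * z3 $ b" if "i < n" for i
    using row[OF 3(1) that] by simp
  have neg: "z1 $ a < 0" "z2 $ b < 0" using 1(3)[OF abc(1)] 2(3)[OF abc(2)] ab by auto
  obtain \<mu> where
    "\<mu> * q $ b + (z3 $ a / z1 $ a) * (q $ b + M $$ (b, a) * z1 $ a) = 0"
    "q $ c + M $$ (c, a) * z3 $ a + M $$ (c, b) * z3 $ b =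
     \<mu> * q $ c + (z3 $ a / z1 $ a) * (q $ c + M $$ (c, a) * z1 $ a) + (z3 $ b / z2 $ b) * (q $ c + M $$ (c, b) * z2 $ b)"
  proof (rule affine_dependence_of_bases)
    show "q $ b + M $$ (b, b) * z2 $ b = 0" using w2[OF abc(2)] 2(3)[OF abc(2)] by simp
    show "q $ b + M $$ (b, a) * z3 $ a + M $$ (b, b) * z3 $ b = 0" using w3[OF abc(2)] 3(3)[OF abc(2)] by simp
  qed (use neg in auto)
  note dep = this[folded w1[OF abc(2)] w1[OF abc(3)] w2[OF abc(3)] w3[OF abc(3)]]
  show ?thesis
    by (rule that[OF q[OF abc(2)] q[OF abc(3)] _ _ _ _ _ _ dep];
        use 1(2)[OF abc(2)] 1(2)[OF abc(3)] 2(2)[OF abc(3)] 3(2)[OF abc(3)]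
          3(3)[OF abc(1)] 3(3)[OF abc(2)] neg ne in \<open>auto simp: divide_simps split: if_splits\<close>)
qed

lemma matousek_outmap_small:
  assumes m: "matousek_USO n G m" and ab: "a < n" "b < n" "a \<noteq> b"
  shows "m {} = {}" 
    "m {a} = {j. j < n \<and> (a, j) \<in> parcs G}"
    "m {a, b} = {j. j < n \<and> ((a, j) \<in> parcs G \<longleftrightarrow> (b, j) \<notin> parcs G)}"
proof -
  show "m {} = {}" using m by (simp add: matousek_USO_def)
  have "{d \<in> {a}. (d, j) \<in> parcs G} = (if (a, j) \<in> parcs G then {a} else {})" for j by auto
  thus "m {a} = {j. j < n \<and> (a, j) \<in> parcs G}"
    using matousek_outmap[OF m, of "{a}"] ab by auto
  have "{d \<in> {a, b}. (d, j) \<in> parcs G} =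
    (if (a, j) \<in> parcs G then {a} else {}) \<union> (if (b, j) \<in> parcs G then {b} else {})" for j by auto
  thus "m {a, b} = {j. j < n \<and> ((a, j) \<in> parcs G \<longleftrightarrow> (b, j) \<notin> parcs G)}"
    using matousek_outmap[OF m, of "{a, b}"] ab by (auto split: if_splits)
qed

text \<open>On three dimensions that induce one of the two graphs, the equation for \<open>w\<^sub>b\<close> fixes the sign of
  \<open>\<mu>\<close>, and with this sign all terms of the equation for \<open>w\<^sub>c\<close> have the sign that \<open>w\<^sub>c\<close> itself
  must not have.\<close>

lemma realizable_imp_no_G1_G2:
  assumes m: "matousek_USO n G m" and re: "realizable n m"
  shows "\<not> contains_induced G graph_G1" "\<not> contains_induced G graph_G2"
proof -
  have dig: "dimension_influence_graph n G" using m by (simp add: matousek_USO_def)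
  note D = dimension_influence_graphD[OF dig]
  have V: "\<forall>d\<in>pverts G. (d, d) \<in> parcs G" using D(2,4) by simp
  note G1 = contains_induced_G1_iff[OF D(1) V] and G2 = contains_induced_G2_iff[OF D(1) V]
  obtain M q where M: "M \<in> carrier_mat n n" and nd: "nondegenerate n M q" and r: "realizes n M q m"
    using re by (auto simp: realizable_def P_matrix_def)
  show "\<not> contains_induced G graph_G1"
  proof
    assume "contains_induced G graph_G1"
    then obtain x y z where *: "distinct [x, y, z]" "x < n" "y < n" "z < n"
      "(x, y) \<in> parcs G" "(y, z) \<in> parcs G" "(x, z) \<notin> parcs G"
      "(y, x) \<notin> parcs G" "(z, y) \<notin> parcs G" "(z, x) \<notin> parcs G"
      unfolding G1 D(2) by auto
    have mm: "m {} = {}" "m {x} = {j. j < n \<and> (x, j) \<in> parcs G}"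
        "m {y} = {j. j < n \<and> (y, j) \<in> parcs G}"
        "m {x, y} = {j. j < n \<and> ((x, j) \<in> parcs G \<longleftrightarrow> (y, j) \<notin> parcs G)}"
      using matousek_outmap_small[OF m, of x y] matousek_outmap_small(2)[OF m, of y x] * by auto
    have out: "x \<in> m {x}" "y \<in> m {x}" "z \<notin> m {x}" "x \<notin> m {y}" "y \<in> m {y}" "z \<in> m {y}"
        "x \<in> m {x, y}" "y \<notin> m {x, y}" "z \<in> m {x, y}"
      using * D(4) unfolding mm by auto
    obtain \<mu> \<alpha> \<beta> qb qc wba wca wcb wc :: real where
      s: "qb > 0" "qc > 0" "\<alpha> > 0" "\<beta> < 0" "wba < 0" "wca > 0" "wcb < 0" "wc < 0"
      and l: "\<mu> * qb + \<alpha> * wba = 0" "wc = \<mu> * qc + \<alpha> * wca + \<beta> * wcb"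
      by (rule signs_at_four_bases[OF M nd r *(2,3,4,1) mm(1) out(1,5)]) (simp only: out if_True if_False)
    have "\<mu> * qb > 0" using l(1) mult_pos_neg[OF s(3,5)] by simp
    hence "\<mu> > 0" using s(1) by (simp add: zero_less_mult_iff)
    hence "wc > 0" unfolding l(2)
      using s by (intro add_pos_pos mult_pos_pos mult_neg_neg)
    thus False using s(8) by simp
  qed
  show "\<not> contains_induced G graph_G2"
  proof
    assume "contains_induced G graph_G2"
    then obtain x y z where *: "distinct [x, y, z]" "x < n" "y < n" "z < n"
      "(x, z) \<in> parcs G" "(y, z) \<in> parcs G" "(x, y) \<notin> parcs G"
      "(y, x) \<notin> parcs G" "(z, y) \<notin> parcs G" "(z, x) \<notin> parcs G"
      unfolding G2 D(2) by auto
    have mm: "m {} = {}" "m {x} = {j. j < n \<and> (x, j) \<in> parcs G}"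
        "m {y} = {j. j < n \<and> (y, j) \<in> parcs G}"
        "m {x, y} = {j. j < n \<and> ((x, j) \<in> parcs G \<longleftrightarrow> (y, j) \<notin> parcs G)}"
      using matousek_outmap_small[OF m, of x y] matousek_outmap_small(2)[OF m, of y x] * by auto
    have out: "x \<in> m {x}" "y \<notin> m {x}" "z \<in> m {x}" "x \<notin> m {y}" "y \<in> m {y}" "z \<in> m {y}"
        "x \<in> m {x, y}" "y \<in> m {x, y}" "z \<notin> m {x, y}"
      using * D(4) unfolding mm by auto
    obtain \<mu> \<alpha> \<beta> qb qc wba wca wcb wc :: real where
      s: "qb > 0" "qc > 0" "\<alpha> > 0" "\<beta> > 0" "wba > 0" "wca < 0" "wcb < 0" "wc > 0"
      and l: "\<mu> * qb + \<alpha> * wba = 0" "wc = \<mu> * qc + \<alpha> * wca + \<beta> * wcb"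
      by (rule signs_at_four_bases[OF M nd r *(2,3,4,1) mm(1) out(1,5)]) (simp only: out if_True if_False)
    have "\<mu> * qb < 0" using l(1) mult_pos_pos[OF s(3,5)] by simp
    hence "\<mu> < 0" using s(1) by (simp add: mult_less_0_iff)
    hence "wc < 0" unfolding l(2)
      using s by (intro add_neg_neg mult_pos_neg mult_neg_pos)
    thus False using s(8) by simp
  qed
qed

section \<open>A P-matrix for every forest order\<close>

text \<open>Such a matrix is triangular up to a simultaneous permutation of rows and columns, so only the
  identity contributes to the Leibniz formula.\<close>

lemma det_ranked:
  fixes A :: "'a::comm_ring_1 mat" and h :: "nat \<Rightarrow> nat"
  assumes A: "A \<in> carrier_mat k k"
    and h: "\<And>i j. i < k \<Longrightarrow> j < k \<Longrightarrow> i \<noteq> j \<Longrightarrow> A $$ (i, j) \<noteq> 0 \<Longrightarrow> h j < h i"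
  shows "det A = (\<Prod>i=0..<k. A $$ (i, i))"
proof -
  have "(\<Prod>i=0..<k. A $$ (i, p i)) = 0" if p: "p permutes {0..<k}" "p \<noteq> id" for p
  proof (rule ccontr)
    assume nz: "(\<Prod>i=0..<k. A $$ (i, p i)) \<noteq> 0"
    have nz': "A $$ (i, p i) \<noteq> 0" if "i < k" for i
    proof
      assume "A $$ (i, p i) = 0"
      hence "\<exists>i\<in>{0..<k}. A $$ (i, p i) = 0" using that by auto
      hence "(\<Prod>i=0..<k. A $$ (i, p i)) = 0" by (intro prod_zero) auto
      thus False using nz by simp
    qed
    have pk: "p i < k" if "i < k" for i
      using permutes_in_image[OF p(1), of i] that by simp
    have le: "h (p i) \<le> h i" if "i \<in> {0..<k}" for i
      using h[of i "p i"] nz'[of i] pk[of i] that by (cases "p i = i") auto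
    \<comment> \<open>A permutation that never increases the rank preserves it, since the sums of the ranks agree.\<close>
    have sums: "(\<Sum>i=0..<k. h (p i)) = (\<Sum>i=0..<k. h i)"
      using sum.permute[OF p(1), of h] by (simp add: o_def)
    have eq: "h (p i) = h i" if "i < k" for i
      by (rule sum_mono_inv[OF sums le]) (use that in auto)
    have "p i = i" if "i < k" for i
      using h[of i "p i"] nz'[OF that] pk[OF that] that eq[OF that] by fastforce
    moreover have "p i = i" if "\<not> i < k" for i
      using p(1) that by (simp add: permutes_not_in)
    ultimately show False using p(2) by (metis eq_id_iff)
  qed
  hence "(\<Sum>p\<in>{p. p permutes {0..<k}}. signof p * (\<Prod>i=0..<k. A $$ (i, p i))) =
      (\<Sum>p\<in>{id}. signof p * (\<Prod>i=0..<k. A $$ (i, p i)))"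
    by (intro sum.mono_neutral_right) (auto simp: finite_permutations permutes_id)
  thus ?thesis using A by (simp add: det_def')
qed

text \<open>The summands are \<open>1, -1, 1, \<dots>\<close> in the order of the ranks.\<close>

lemma sum_signs_by_rank:
  fixes h :: "'a \<Rightarrow> nat"
  assumes "finite T" "inj_on h T"
  shows "2 * (\<Sum>i\<in>T. (- 1) ^ card {k \<in> T. h k < h i}) = (1 - (- 1) ^ card T :: real)"
  using assms
proof (induction T rule: finite_ranking_induct[where f = h])
  case empty
  thus ?case by simp
next
  case (insert x S)
  show ?case
  proof (cases "x \<in> S")
    case True
    thus ?thesis using insert.IH insert.prems by (simp add: insert_absorb)
  next
    case False
    have less: "h y < h x" if "y \<in> S" for y
      using insert.hyps(2)[OF that] insert.prems that False by (metis inj_onD insertI1 insertI2 le_neq_implies_less)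
    have "{k \<in> insert x S. h k < h i} = {k \<in> S. h k < h i}" if "i \<in> S" for i
      using less[OF that] by auto
    moreover have "{k \<in> insert x S. h k < h x} = S" using less by auto
    ultimately have "(\<Sum>i\<in>insert x S. (- 1) ^ card {k \<in> insert x S. h k < h i}) =
        (- 1) ^ card S + (\<Sum>i\<in>S. (- 1) ^ card {k \<in> S. h k < h i} :: real)"
      using False insert.hyps(1) by simp
    thus ?thesis using insert.IH insert.prems False insert.hyps(1) by (simp add: distrib_left)
  qed
qed

locale forest =
  fixes n :: nat and E :: "(nat \<times> nat) set"
  assumes forest: "forest_order n E"
begin

lemmas forestD = forest_orderD[OF forest]

definition height :: "nat \<Rightarrow> nat" where
  "height j = card {d. (d, j) \<in> E}"

lemma finite_ancestors: "finite {d. (d, j) \<in> E}"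
  by (rule finite_subset[of _ "{..<n}"]) (use forestD(1) in auto)

lemma height_less: "(i, j) \<in> E \<Longrightarrow> i \<noteq> j \<Longrightarrow> height i < height j"
  unfolding height_def
  by (rule psubset_card_mono[OF finite_ancestors]) (use forestD(2,3,4,5) in blast)

lemma ancestors_by_height:
  assumes "(i, j) \<in> E" "(k, j) \<in> E"
  shows "height k < height i \<longleftrightarrow> (k, i) \<in> E \<and> k \<noteq> i"
  using forestD(6)[OF assms] height_less by fastforce

definition strict_ancestors_in :: "nat set \<Rightarrow> nat \<Rightarrow> nat set" where
  "strict_ancestors_in B j = {i \<in> B. (i, j) \<in> E \<and> i \<noteq> j}"

lemma finite_strict_ancestors_in: "finite (strict_ancestors_in B j)"
  by (rule finite_subset[OF _ finite_ancestors[of j]]) (auto simp: strict_ancestors_in_def)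

lemma sum_strict_ancestor_signs:
  "2 * (\<Sum>i\<in>strict_ancestors_in B j. (- 1) ^ card (strict_ancestors_in B i)) =
   (1 - (- 1) ^ card (strict_ancestors_in B j) :: real)"
proof -
  let ?T = "strict_ancestors_in B j"
  have inj: "inj_on height ?T"
  proof (rule inj_onI)
    fix i k assume ik: "i \<in> ?T" "k \<in> ?T" "height i = height k"
    hence "(i, j) \<in> E" "(k, j) \<in> E" by (auto simp: strict_ancestors_in_def)
    thus "i = k" using forestD(6)[of i j k] height_less ik(3) by fastforce
  qed
  have "{k \<in> ?T. height k < height i} = strict_ancestors_in B i" if "i \<in> ?T" for i
    using that ancestors_by_height[of i j] forestD(4,5) unfolding strict_ancestors_in_def by blast
  thus ?thesis using sum_signs_by_rank[OF finite_strict_ancestors_in inj] by simp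
qed

text \<open>With \<open>q = 1\<close> everywhere, this matrix makes the solution at \<open>B\<close> satisfy \<open>x\<^sub>j = 1 - 2 \<Sum> x\<^sub>i\<close>,
  where \<open>x = w - z\<close> and the sum is over the strict ancestors \<open>i \<in> B\<close> of \<open>j\<close>. As these form a chain,
  the values are \<open>1\<close> and \<open>-1\<close> in turn, which is the parity that the outmap asks for.\<close>

definition forest_mat :: "real mat" where
  "forest_mat = mat n n (\<lambda>(j, i). if i = j then 1 else if (i, j) \<in> E then 2 else 0)"

lemma P_matrix_forest_mat: "P_matrix n forest_mat"
  unfolding P_matrix_def
proof (intro conjI allI impI)
  show "forest_mat \<in> carrier_mat n n" by (simp add: forest_mat_def)
  fix S assume S: "S \<subseteq> {..<n} \<and> S \<noteq> {}"
  define k where "k = card S"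
  have fin: "finite S" using S finite_subset by blast
  have SS: "{i. i < n \<and> i \<in> S} = S" using S by auto
  have pick: "pick S i \<in> S" "pick S i < n" if "i < k" for i
    using pick_in_set_le[of i S] that S by (auto simp: k_def)
  have pick_inj: "pick S i = pick S j \<longleftrightarrow> i = j" if "i < k" "j < k" for i j
    using card_pick_le[of i S] card_pick_le[of j S] that unfolding k_def by metis
  have sub: "submatrix forest_mat S S \<in> carrier_mat k k"
    by (simp add: submatrix_def forest_mat_def SS k_def)
  have ent: "submatrix forest_mat S S $$ (j, i) =
      (if i = j then 1 else if (pick S i, pick S j) \<in> E then 2 else 0)" if "i < k" "j < k" for i j
    using that pick pick_inj[of i j] by (simp add: submatrix_def forest_mat_def SS k_def)
  have "det (submatrix forest_mat S S) = (\<Prod>i=0..<k. submatrix forest_mat S S $$ (i, i))"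
    by (rule det_ranked[OF sub, of "\<lambda>i. height (pick S i)"])
       (use ent height_less pick_inj in \<open>auto split: if_splits\<close>)
  thus "det (submatrix forest_mat S S) > 0" using ent by simp
qed

text \<open>Since \<open>w\<close> and \<open>z\<close> have complementary supports, \<open>x = w - z\<close> determines both, and the linear
  system turns into a recursion along the ancestors.\<close>

lemma candidate_solution_forest_iff:
  assumes B: "B \<subseteq> {..<n}"
    and w: "w \<in> carrier_vec n" and z: "z \<in> carrier_vec n"
    and zero: "\<And>i. i < n \<Longrightarrow> (i \<in> B \<longrightarrow> w $ i = 0) \<and> (i \<notin> B \<longrightarrow> z $ i = 0)"
  shows "candidate_solution_at n forest_mat (vec n (\<lambda>_. 1)) B w z \<longleftrightarrow>
    (\<forall>j<n. w $ j - z $ j = 1 - 2 * (\<Sum>i\<in>strict_ancestors_in B j. w $ i - z $ i))"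
proof -
  have "(forest_mat *\<^sub>v z) $ j = z $ j - 2 * (\<Sum>i\<in>strict_ancestors_in B j. w $ i - z $ i)"
    if j: "j < n" for j
  proof -
    have "(forest_mat *\<^sub>v z) $ j = (\<Sum>i<n. (if i = j then 1 else if (i, j) \<in> E then 2 else 0) * z $ i)"
      using z j by (auto simp: forest_mat_def scalar_prod_def atLeast0LessThan intro!: sum.cong)
    also have "\<dots> = (\<Sum>i<n. (if i = j then z $ j else 0) + (if i \<in> strict_ancestors_in B j then 2 * z $ i else 0))"
      using zero by (intro sum.cong) (auto simp: strict_ancestors_in_def)
    also have "\<dots> = z $ j + (\<Sum>i<n. if i \<in> strict_ancestors_in B j then 2 * z $ i else 0)"
      using j by (simp add: sum.distrib)
    also have "(\<Sum>i<n. if i \<in> strict_ancestors_in B j then 2 * z $ i else 0) =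
        (\<Sum>i\<in>strict_ancestors_in B j. 2 * z $ i)"
      by (rule sum.mono_neutral_cong_right) (use B in \<open>auto simp: strict_ancestors_in_def\<close>)
    also have "\<dots> = (\<Sum>i\<in>strict_ancestors_in B j. - 2 * (w $ i - z $ i))"
      by (rule sum.cong) (use zero B in \<open>auto simp: strict_ancestors_in_def\<close>)
    also have "\<dots> = - 2 * (\<Sum>i\<in>strict_ancestors_in B j. w $ i - z $ i)"
      by (simp only: sum_distrib_left)
    finally show ?thesis by simp
  qed
  note row = this
  have dim: "dim_vec (forest_mat *\<^sub>v z) = n" by (simp add: forest_mat_def)
  have "w - forest_mat *\<^sub>v z = vec n (\<lambda>_. 1) \<longleftrightarrow> (\<forall>j<n. w $ j - (forest_mat *\<^sub>v z) $ j = 1)"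
    using w dim by (auto simp: vec_eq_iff)
  also have "\<dots> \<longleftrightarrow> (\<forall>j<n. w $ j - z $ j = 1 - 2 * (\<Sum>i\<in>strict_ancestors_in B j. w $ i - z $ i))"
    by (intro all_cong) (auto simp: row)
  finally show ?thesis using w z zero
    unfolding candidate_solution_at_def candidate_solution_def by blast
qed

lemma candidate_solution_forest_unique:
  assumes B: "B \<subseteq> {..<n}" and c: "candidate_solution_at n forest_mat (vec n (\<lambda>_. 1)) B w z"
    and j: "j < n"
  shows "w $ j - z $ j = (- 1) ^ card (strict_ancestors_in B j)"
  using j
proof (induction "height j" arbitrary: j rule: less_induct)
  case less
  have wz: "w \<in> carrier_vec n" "z \<in> carrier_vec n"
      "\<And>i. i < n \<Longrightarrow> (i \<in> B \<longrightarrow> w $ i = 0) \<and> (i \<notin> B \<longrightarrow> z $ i = 0)"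
    using c by (auto simp: candidate_solution_at_def candidate_solution_def)
  have "w $ j - z $ j = 1 - 2 * (\<Sum>i\<in>strict_ancestors_in B j. w $ i - z $ i)"
    using c candidate_solution_forest_iff[OF B wz] less.prems by blast
  also have "(\<Sum>i\<in>strict_ancestors_in B j. w $ i - z $ i) =
      (\<Sum>i\<in>strict_ancestors_in B j. (- 1) ^ card (strict_ancestors_in B i))"
    using height_less forestD(1)
    by (intro sum.cong less.hyps) (auto simp: strict_ancestors_in_def)
  also have "1 - 2 * \<dots> = (- 1) ^ card (strict_ancestors_in B j)"
    by (simp add: sum_strict_ancestor_signs)
  finally show ?case .
qed

lemma candidate_solution_forest_exists:
  assumes B: "B \<subseteq> {..<n}"
  shows "\<exists>w z. candidate_solution_at n forest_mat (vec n (\<lambda>_. 1)) B w z"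
proof -
  let ?x = "\<lambda>j. (- 1) ^ card (strict_ancestors_in B j) :: real"
  let ?w = "vec n (\<lambda>j. if j \<in> B then 0 else ?x j)" and ?z = "vec n (\<lambda>j. if j \<in> B then - ?x j else 0)"
  have "?w $ j - ?z $ j = ?x j" if "j < n" for j using that by simp
  moreover have "(\<Sum>i\<in>strict_ancestors_in B j. ?w $ i - ?z $ i) = (\<Sum>i\<in>strict_ancestors_in B j. ?x i)" for j
    by (rule sum.cong) (use B in \<open>auto simp: strict_ancestors_in_def\<close>)
  ultimately have "candidate_solution_at n forest_mat (vec n (\<lambda>_. 1)) B ?w ?z"
    by (subst candidate_solution_forest_iff[OF B]) (simp_all add: sum_strict_ancestor_signs)
  thus ?thesis by blast
qed

end

lemma forest_imp_realizable:
  assumes m: "matousek_USO n G m" and E: "forest_order n (parcs G)"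
  shows "realizable n m"
proof -
  interpret forest n "parcs G" by unfold_locales (rule E)
  let ?q = "vec n (\<lambda>_. 1) :: real vec"
  have signs: "w $ i = (if i \<in> B then 0 else (- 1) ^ card (strict_ancestors_in B i))"
      "z $ i = (if i \<in> B then - ((- 1) ^ card (strict_ancestors_in B i)) else 0)"
    if "candidate_solution_at n forest_mat ?q B w z" "B \<subseteq> {..<n}" "i < n" for B w z i
    using that candidate_solution_forest_unique[OF that(2,1,3)]
    by (auto simp: candidate_solution_at_def)
  have "nondegenerate n forest_mat ?q"
    unfolding nondegenerate_def by (auto simp: signs split: if_splits)
  moreover have "realizes n forest_mat ?q m"
    unfolding realizes_def
  proof (intro allI impI)
    fix B assume B: "B \<subseteq> {..<n}"
    then obtain w z where c: "candidate_solution_at n forest_mat ?q B w z"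
      using candidate_solution_forest_exists by blast
    have "i \<in> m B \<longleftrightarrow> w $ i \<le> 0 \<and> z $ i \<le> 0" if i: "i < n" for i
    proof -
      have "{d \<in> B. (d, i) \<in> parcs G} =
          (if i \<in> B then insert i (strict_ancestors_in B i) else strict_ancestors_in B i)"
        using forestD(3)[OF i] by (auto simp: strict_ancestors_in_def)
      moreover have "i \<notin> strict_ancestors_in B i" by (simp add: strict_ancestors_in_def)
      ultimately have "i \<in> m B \<longleftrightarrow> odd (card (strict_ancestors_in B i)) \<noteq> (i \<in> B)"
        using matousek_outmap[OF m B] i finite_strict_ancestors_in by auto
      thus ?thesis using signs[OF c B i] by auto
    qed
    moreover have "m B \<subseteq> {..<n}" using matousek_outmap[OF m B] by auto
    ultimately have "m B = {i. i < n \<and> w $ i \<le> 0 \<and> z $ i \<le> 0}" by auto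
    thus "\<exists>w z. candidate_solution_at n forest_mat ?q B w z \<and> m B = {i. i < n \<and> w $ i \<le> 0 \<and> z $ i \<le> 0}"
      using c by blast
  qed
  ultimately show ?thesis
    unfolding realizable_def using matousek_USO_on_forest_is_USO[OF m E] P_matrix_forest_mat
    by (intro conjI exI[of _ forest_mat] exI[of _ ?q]) auto
qed

section \<open>Oriented matroids of vector configurations, and operations on oriented matroids\<close>

text \<open>The functions whose sign patterns are the circuits of a vector configuration.\<close>

definition minimal_dependence :: "'a set \<Rightarrow> nat \<Rightarrow> ('a \<Rightarrow> nat \<Rightarrow> real) \<Rightarrow> ('a \<Rightarrow> real) \<Rightarrow> bool" where
  "minimal_dependence E r V c \<longleftrightarrow> lin_dependence E r V c \<and> (\<exists>e. c e \<noteq> 0) \<and>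
     (\<forall>c'. lin_dependence E r V c' \<and> (\<exists>e. c' e \<noteq> 0) \<and> {e. c' e \<noteq> 0} \<subseteq> {e. c e \<noteq> 0} \<longrightarrow>
        {e. c' e \<noteq> 0} = {e. c e \<noteq> 0})"

lemma vector_circuits_eq:
  "vector_circuits E r V = {({e. c e > 0}, {e. c e < 0}) | c. minimal_dependence E r V c}"
  unfolding vector_circuits_def minimal_dependence_def by simp

lemma lin_dependence_combine:
  assumes "lin_dependence E r V c" "lin_dependence E r V d"
  shows "lin_dependence E r V (\<lambda>e. a * c e + b * d e)"
proof -
  have "(\<Sum>e\<in>E. (a * c e + b * d e) * V e k) = a * (\<Sum>e\<in>E. c e * V e k) + b * (\<Sum>e\<in>E. d e * V e k)" for k
    by (simp add: sum_distrib_left sum.distrib[symmetric] algebra_simps)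
  thus ?thesis using assms by (simp add: lin_dependence_def)
qed

text \<open>Otherwise the combination of the two that cancels at \<open>e\<close> would be a nonzero dependence whose
  support is too small.\<close>

lemma minimal_dependence_proportional:
  assumes c: "minimal_dependence E r V c" and d: "minimal_dependence E r V d"
    and sub: "{e. c e \<noteq> 0} \<subseteq> {e. d e \<noteq> 0}" and e: "c e \<noteq> 0"
  shows "d e * c f = c e * d f"
proof (rule ccontr)
  assume ne: "d e * c f \<noteq> c e * d f"
  let ?z = "\<lambda>f. d e * c f + (- c e) * d f"
  have "lin_dependence E r V ?z"
    using c d by (intro lin_dependence_combine) (auto simp: minimal_dependence_def)
  moreover have "\<exists>f. ?z f \<noteq> 0" using ne by auto
  moreover have "{f. ?z f \<noteq> 0} \<subseteq> {f. d f \<noteq> 0}" using sub by auto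
  ultimately have "{f. ?z f \<noteq> 0} = {f. d f \<noteq> 0}"
    using d unfolding minimal_dependence_def by blast
  moreover have "e \<in> {f. d f \<noteq> 0}" using sub e by auto
  ultimately have "e \<in> {f. ?z f \<noteq> 0}" by (simp only:)
  thus False by simp
qed

text \<open>If \<open>z\<close> does not have minimal support, there is a nonzero dependence of smaller support; moving
  along it from \<open>z\<close> until the first coordinate becomes zero shrinks the support without creating a
  new sign.\<close>

lemma conformal_minimal_dependence:
  assumes fin: "finite E" and z: "lin_dependence E r V z" "\<exists>e. z e \<noteq> 0"
  obtains y where "minimal_dependence E r V y"
    "{e. y e > 0} \<subseteq> {e. z e > 0}" "{e. y e < 0} \<subseteq> {e. z e < 0}"
proof -
  have "\<exists>y. minimal_dependence E r V y \<and> {e. y e > 0} \<subseteq> {e. z e > 0} \<and> {e. y e < 0} \<subseteq> {e. z e < 0}"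
    using z
  proof (induction "card {e. z e \<noteq> 0}" arbitrary: z rule: less_induct)
    case less
    have finz: "finite {e. z e \<noteq> 0}"
      by (rule finite_subset[OF _ fin]) (use less.prems in \<open>auto simp: lin_dependence_def\<close>)
    show ?case
    proof (cases "minimal_dependence E r V z")
      case False
      then obtain c0 where c0: "lin_dependence E r V c0" "\<exists>e. c0 e \<noteq> 0"
        "{e. c0 e \<noteq> 0} \<subset> {e. z e \<noteq> 0}"
        using less.prems unfolding minimal_dependence_def by blast
      then obtain e1 where e1: "c0 e1 \<noteq> 0" "z e1 \<noteq> 0" by blast
      define c where "c e = sgn (c0 e1) * sgn (z e1) * c0 e" for e
      have supp_c: "c e \<noteq> 0 \<longleftrightarrow> c0 e \<noteq> 0" for e using e1 by (simp add: c_def sgn_eq_0_iff)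
      have c: "lin_dependence E r V c"
        using lin_dependence_combine[OF c0(1) c0(1), of "sgn (c0 e1) * sgn (z e1)" 0]
        by (simp add: c_def[abs_def])
      define T where "T = {e. 0 < c e * z e}"
      have "c e1 * z e1 = \<bar>c0 e1\<bar> * \<bar>z e1\<bar>"
        by (simp add: c_def abs_sgn mult_ac)
      hence T: "e1 \<in> T" "finite T"
        using e1 by (auto simp: T_def intro: finite_subset[OF _ finz])
      define t where "t = Min ((\<lambda>e. z e / c e) ` T)"
      have tmin: "t \<le> z e / c e" if "e \<in> T" for e
        using T that by (auto simp: t_def)
      have "t \<in> (\<lambda>e. z e / c e) ` T" unfolding t_def by (rule Min_in) (use T in auto)
      then obtain e2 where e2: "e2 \<in> T" "t = z e2 / c e2" by blast
      have t: "t > 0" using e2 by (auto simp: T_def zero_less_mult_iff zero_less_divide_iff)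
      \<comment> \<open>Subtract from \<open>z\<close> the largest multiple of \<open>c\<close> that does not reverse a sign.\<close>
      define z' where "z' e = z e - t * c e" for e
      have dep': "lin_dependence E r V z'"
        using lin_dependence_combine[OF less.prems(1) c, of 1 "- t"] by (simp add: z'_def[abs_def])
      have zc: "c e = 0" if "z e = 0" for e using c0(3) supp_c[of e] that by blast
      have pos: "z e > 0" if z': "z' e > 0" for e
      proof (rule ccontr)
        assume n: "\<not> z e > 0"
        show False
        proof (cases "c e < 0 \<and> z e < 0")
          case True
          hence "e \<in> T" by (simp add: T_def mult_neg_neg)
          hence "z e \<le> t * c e" using tmin[of e] True by (simp add: neg_le_divide_eq mult.commute)
          thus False using z' by (simp add: z'_def)
        next
          case False
          hence "c e \<ge> 0" using n zc[of e] by fastforce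
          hence "t * c e \<ge> 0" using t by simp
          thus False using z' n by (simp add: z'_def)
        qed
      qed
      have neg: "z e < 0" if z': "z' e < 0" for e
      proof (rule ccontr)
        assume n: "\<not> z e < 0"
        show False
        proof (cases "c e > 0 \<and> z e > 0")
          case True
          hence "e \<in> T" by (simp add: T_def)
          hence "t * c e \<le> z e" using tmin[of e] True by (simp add: pos_le_divide_eq)
          thus False using z' by (simp add: z'_def)
        next
          case False
          hence "c e \<le> 0" using n zc[of e] by fastforce
          hence "t * c e \<le> 0" using t by (simp add: mult_le_0_iff)
          thus False using z' n by (simp add: z'_def)
        qed
      qed
      have "c e2 \<noteq> 0" "z e2 \<noteq> 0" using e2(1) by (auto simp: T_def)
      hence "e2 \<notin> {e. z' e \<noteq> 0}" "e2 \<in> {e. z e \<noteq> 0}" using e2(2) by (auto simp: z'_def)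
      moreover have "{e. z' e \<noteq> 0} \<subseteq> {e. z e \<noteq> 0}" using zc by (auto simp: z'_def)
      ultimately have "card {e. z' e \<noteq> 0} < card {e. z e \<noteq> 0}"
        by (intro psubset_card_mono[OF finz]) blast
      moreover obtain e3 where "z e3 \<noteq> 0" "c e3 = 0" using c0(3) supp_c by blast
      hence "\<exists>e. z' e \<noteq> 0" by (intro exI[of _ e3]) (simp add: z'_def)
      ultimately obtain y where "minimal_dependence E r V y"
        "{e. y e > 0} \<subseteq> {e. z' e > 0}" "{e. y e < 0} \<subseteq> {e. z' e < 0}"
        using less.hyps dep' by blast
      thus ?thesis using pos neg by blast
    qed blast
  qed
  thus ?thesis using that by blast
qed

text \<open>The positive combination of \<open>c\<close> and \<open>d\<close> that vanishes at \<open>e\<close> is nonzero unless the two circuits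
  are opposite, and a minimal dependence conformal to it eliminates \<open>e\<close>.\<close>

lemma vector_circuits_elimination:
  assumes fin: "finite E"
    and c: "minimal_dependence E r V c" and d: "minimal_dependence E r V d"
    and ne: "({e. c e > 0}, {e. c e < 0}) \<noteq> opposite ({e. d e > 0}, {e. d e < 0})"
    and e: "c e > 0" "d e < 0"
  obtains y where "minimal_dependence E r V y"
    "{f. y f > 0} \<subseteq> ({f. c f > 0} \<union> {f. d f > 0}) - {e}"
    "{f. y f < 0} \<subseteq> ({f. c f < 0} \<union> {f. d f < 0}) - {e}"
proof -
  let ?z = "\<lambda>f. (- d e) * c f + c e * d f"
  have nz: "\<exists>f. ?z f \<noteq> 0"
  proof (rule ccontr)
    assume "\<nexists>f. ?z f \<noteq> 0"
    hence eq: "(- d e) * c f = - (c e * d f)" for f by (metis add.inverse_unique add.commute)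
    have "c f > 0 \<longleftrightarrow> (- d e) * c f > 0" "c f < 0 \<longleftrightarrow> (- d e) * c f < 0"
      "d f > 0 \<longleftrightarrow> c e * d f > 0" "d f < 0 \<longleftrightarrow> c e * d f < 0" for f
      using e by (simp_all add: zero_less_mult_iff mult_less_0_iff)
    hence "c f > 0 \<longleftrightarrow> d f < 0" "c f < 0 \<longleftrightarrow> d f > 0" for f
      unfolding eq by simp_all
    thus False using ne by (simp add: opposite_def)
  qed
  have "lin_dependence E r V ?z"
    using c d by (intro lin_dependence_combine) (auto simp: minimal_dependence_def)
  then obtain y where y: "minimal_dependence E r V y"
    "{f. y f > 0} \<subseteq> {f. ?z f > 0}" "{f. y f < 0} \<subseteq> {f. ?z f < 0}"
    using conformal_minimal_dependence[OF fin _ nz] by blast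
  have "{f. ?z f > 0} \<subseteq> ({f. c f > 0} \<union> {f. d f > 0}) - {e}"
  proof
    fix f assume f: "f \<in> {f. ?z f > 0}"
    have "c f > 0 \<or> d f > 0"
    proof (rule ccontr)
      assume "\<not> (c f > 0 \<or> d f > 0)"
      hence "?z f \<le> 0" using e by (intro add_nonpos_nonpos mult_nonneg_nonpos) auto
      thus False using f by simp
    qed
    moreover have "f \<noteq> e" using f by auto
    ultimately show "f \<in> ({f. c f > 0} \<union> {f. d f > 0}) - {e}" by simp
  qed
  moreover have "{f. ?z f < 0} \<subseteq> ({f. c f < 0} \<union> {f. d f < 0}) - {e}"
  proof
    fix f assume f: "f \<in> {f. ?z f < 0}"
    have "c f < 0 \<or> d f < 0"
    proof (rule ccontr)
      assume "\<not> (c f < 0 \<or> d f < 0)"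
      hence "0 \<le> ?z f" using e by (intro add_nonneg_nonneg mult_nonneg_nonneg) auto
      thus False using f by simp
    qed
    moreover have "f \<noteq> e" using f by auto
    ultimately show "f \<in> ({f. c f < 0} \<union> {f. d f < 0}) - {e}" by simp
  qed
  ultimately show ?thesis using that y by blast
qed

lemma oriented_matroid_vector_circuits:
  assumes fin: "finite E"
  shows "oriented_matroid E (vector_circuits E r V)"
  unfolding oriented_matroid_def
proof (intro conjI ballI allI impI)
  let ?sg = "\<lambda>c :: 'a \<Rightarrow> real. ({e. c e > 0}, {e. c e < 0})"
  let ?min = "minimal_dependence E r V"
  have memD: "\<exists>c. C = ?sg c \<and> ?min c" if "C \<in> vector_circuits E r V" for C
    using that unfolding vector_circuits_eq by blast
  have memI: "?sg c \<in> vector_circuits E r V" if "?min c" for c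
    using that unfolding vector_circuits_eq by blast
  have supp: "supp (?sg c) = {e. c e \<noteq> 0}" for c by (auto simp: supp_def)
  show "finite E" by (rule fin)
  show "({}, {}) \<notin> vector_circuits E r V"
    using supp by (force dest!: memD simp: minimal_dependence_def supp_def)
  fix C assume "C \<in> vector_circuits E r V"
  then obtain c where c: "C = ?sg c" "?min c" using memD by blast
  show "fst C \<inter> snd C = {}" using c by auto
  show "supp C \<subseteq> E" using c supp by (auto simp: minimal_dependence_def lin_dependence_def)
  show "opposite C \<in> vector_circuits E r V"
  proof -
    have "lin_dependence E r V (\<lambda>e. - c e)"
      using c(2) by (auto simp: minimal_dependence_def lin_dependence_def sum_negf)
    hence "?min (\<lambda>e. - c e)" using c(2) unfolding minimal_dependence_def by simp
    from memI[OF this] show ?thesis by (simp add: c(1) opposite_def)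
  qed
  fix D assume "D \<in> vector_circuits E r V"
  then obtain d where d: "D = ?sg d" "?min d" using memD by blast
  show "C = D \<or> C = opposite D" if "supp C \<subseteq> supp D"
  proof -
    have sub: "{e. c e \<noteq> 0} \<subseteq> {e. d e \<noteq> 0}" using that supp by (simp add: c d)
    obtain e where e: "c e \<noteq> 0" using c(2) by (auto simp: minimal_dependence_def)
    hence de: "d e \<noteq> 0" using sub by auto
    obtain k where k: "k \<noteq> 0" and cf: "\<And>f. c f = k * d f"
    proof (rule that[of "c e / d e"])
      show "c f = (c e / d e) * d f" for f
        using minimal_dependence_proportional[OF c(2) d(2) sub e, of f] de by (simp add: field_simps)
    qed (use e de in simp)
    show ?thesis
    proof (cases "k > 0")
      case True
      hence "c f > 0 \<longleftrightarrow> d f > 0" "c f < 0 \<longleftrightarrow> d f < 0" for f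
        unfolding cf by (simp_all add: zero_less_mult_iff mult_less_0_iff)
      thus ?thesis by (simp add: c d)
    next
      case False
      hence "k < 0" using k by simp
      hence "c f > 0 \<longleftrightarrow> d f < 0" "c f < 0 \<longleftrightarrow> d f > 0" for f
        unfolding cf by (simp_all add: zero_less_mult_iff mult_less_0_iff)
      thus ?thesis by (simp add: c d opposite_def)
    qed
  qed
  fix e assume e: "C \<noteq> opposite D \<and> e \<in> fst C \<inter> snd D"
  then obtain y where "?min y"
    "{f. y f > 0} \<subseteq> ({f. c f > 0} \<union> {f. d f > 0}) - {e}"
    "{f. y f < 0} \<subseteq> ({f. c f < 0} \<union> {f. d f < 0}) - {e}"
    using vector_circuits_elimination[OF fin c(2) d(2)] unfolding c d by auto
  thus "\<exists>Z\<in>vector_circuits E r V. fst Z \<subseteq> (fst C \<union> fst D) - {e} \<and> snd Z \<subseteq> (snd C \<union> snd D) - {e}"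
    using memI unfolding c d by (intro bexI[of _ "?sg y"]) auto
qed

lemma oriented_matroidD:
  assumes "oriented_matroid E \<C>" "C \<in> \<C>"
  shows "fst C \<inter> snd C = {}" "supp C \<subseteq> E" "opposite C \<in> \<C>"
    "D \<in> \<C> \<Longrightarrow> supp C \<subseteq> supp D \<Longrightarrow> C = D \<or> C = opposite D"
    "D \<in> \<C> \<Longrightarrow> C \<noteq> opposite D \<Longrightarrow> e \<in> fst C \<inter> snd D \<Longrightarrow>
      \<exists>Z\<in>\<C>. fst Z \<subseteq> (fst C \<union> fst D) - {e} \<and> snd Z \<subseteq> (snd C \<union> snd D) - {e}"
proof -
  note om = assms(1)[unfolded oriented_matroid_def]
  show "fst C \<inter> snd C = {}" "supp C \<subseteq> E" "opposite C \<in> \<C>" using om assms(2) by simp_all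
  show "C = D \<or> C = opposite D" if "D \<in> \<C>" "supp C \<subseteq> supp D"
    using om assms(2) that by simp
  from om have "\<forall>C\<in>\<C>. \<forall>D\<in>\<C>. \<forall>e. C \<noteq> opposite D \<and> e \<in> fst C \<inter> snd D \<longrightarrow>
      (\<exists>Z\<in>\<C>. fst Z \<subseteq> (fst C \<union> fst D) - {e} \<and> snd Z \<subseteq> (snd C \<union> snd D) - {e})"
    by (elim conjE)
  from this[rule_format, OF assms(2)]
  show "\<exists>Z\<in>\<C>. fst Z \<subseteq> (fst C \<union> fst D) - {e} \<and> snd Z \<subseteq> (snd C \<union> snd D) - {e}"
    if "D \<in> \<C>" "C \<noteq> opposite D" "e \<in> fst C \<inter> snd D"
    using that by blast
qed

definition reorient_signed :: "'a set \<Rightarrow> 'a signed_set \<Rightarrow> 'a signed_set" where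
  "reorient_signed F C = ((fst C - F) \<union> (snd C \<inter> F), (snd C - F) \<union> (fst C \<inter> F))"

lemma reorient_eq: "reorient F \<C> = reorient_signed F ` \<C>"
  unfolding reorient_def by (rule image_cong) (auto simp: reorient_signed_def split: prod.splits)

lemma reorient_signed_simps:
  "supp (reorient_signed F C) = supp C"
  "reorient_signed F (reorient_signed F C) = C"
  "reorient_signed F (opposite C) = opposite (reorient_signed F C)"
  by (auto simp: reorient_signed_def supp_def opposite_def prod_eq_iff)

lemma oriented_matroid_reorient:
  assumes om: "oriented_matroid E \<C>"
  shows "oriented_matroid E (reorient F \<C>)"
  unfolding oriented_matroid_def reorient_eq ball_simps
proof (intro conjI ballI allI impI)
  let ?\<rho> = "reorient_signed F"
  show "finite E" using om by (simp add: oriented_matroid_def)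
  show "({}, {}) \<notin> ?\<rho> ` \<C>"
  proof
    assume "({}, {}) \<in> ?\<rho> ` \<C>"
    then obtain C where C: "C \<in> \<C>" "?\<rho> C = ({}, {})" by force
    hence "supp C = {}" using reorient_signed_simps(1)[of F C] by (simp add: supp_def)
    hence "C = ({}, {})" by (auto simp: supp_def prod_eq_iff)
    thus False using C(1) om by (simp add: oriented_matroid_def)
  qed
  fix C assume C: "C \<in> \<C>"
  note omC = oriented_matroidD[OF om C]
  show "fst (?\<rho> C) \<inter> snd (?\<rho> C) = {}" using omC(1) by (auto simp: reorient_signed_def)
  show "supp (?\<rho> C) \<subseteq> E" using omC(2) by (simp add: reorient_signed_simps)
  show "opposite (?\<rho> C) \<in> ?\<rho> ` \<C>"
    using omC(3) by (simp add: reorient_signed_simps(3)[symmetric])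
  fix D assume D: "D \<in> \<C>"
  show "?\<rho> C = ?\<rho> D \<or> ?\<rho> C = opposite (?\<rho> D)" if "supp (?\<rho> C) \<subseteq> supp (?\<rho> D)"
    using that omC(4)[OF D] by (auto simp: reorient_signed_simps)
  fix e assume e: "?\<rho> C \<noteq> opposite (?\<rho> D) \<and> e \<in> fst (?\<rho> C) \<inter> snd (?\<rho> D)"
  have ne: "C \<noteq> opposite D" using e by (auto simp: reorient_signed_simps)
  hence ne': "D \<noteq> opposite C" by (auto simp: opposite_def)
  have "\<exists>Z\<in>\<C>. fst Z \<subseteq> (fst C \<union> fst D) - {e} \<and> snd Z \<subseteq> (snd C \<union> snd D) - {e}"
  proof (cases "e \<in> F")
    case True
    hence "e \<in> fst D \<inter> snd C" using e by (auto simp: reorient_signed_def)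
    thus ?thesis using oriented_matroidD(5)[OF om D C ne'] by (simp add: Un_commute)
  next
    case False
    hence "e \<in> fst C \<inter> snd D" using e by (auto simp: reorient_signed_def)
    thus ?thesis using omC(5)[OF D ne] by simp
  qed
  then obtain Z where Z: "Z \<in> \<C>" "fst Z \<subseteq> (fst C \<union> fst D) - {e}" "snd Z \<subseteq> (snd C \<union> snd D) - {e}"
    by blast
  have "fst (?\<rho> Z) \<subseteq> (fst (?\<rho> C) \<union> fst (?\<rho> D)) - {e} \<and> snd (?\<rho> Z) \<subseteq> (snd (?\<rho> C) \<union> snd (?\<rho> D)) - {e}"
    using Z(2,3) unfolding reorient_signed_def by auto
  thus "\<exists>Z\<in>?\<rho> ` \<C>. fst Z \<subseteq> (fst (?\<rho> C) \<union> fst (?\<rho> D)) - {e} \<and>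
      snd Z \<subseteq> (snd (?\<rho> C) \<union> snd (?\<rho> D)) - {e}"
    using Z(1) by blast
qed

definition relabel_signed :: "('a \<Rightarrow> 'b) \<Rightarrow> 'a signed_set \<Rightarrow> 'b signed_set" where
  "relabel_signed \<pi> C = (\<pi> ` fst C, \<pi> ` snd C)"

lemma relabel_eq: "relabel \<pi> \<C> = relabel_signed \<pi> ` \<C>"
  unfolding relabel_def by (rule image_cong) (auto simp: relabel_signed_def split: prod.splits)

lemma relabel_signed_simps:
  "supp (relabel_signed \<pi> C) = \<pi> ` supp C"
  "relabel_signed \<pi> (opposite C) = opposite (relabel_signed \<pi> C)"
  by (auto simp: relabel_signed_def supp_def opposite_def)

lemma oriented_matroid_relabel:
  assumes om: "oriented_matroid E \<C>" and inj: "inj \<pi>"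
  shows "oriented_matroid (\<pi> ` E) (relabel \<pi> \<C>)"
  unfolding oriented_matroid_def relabel_eq ball_simps
proof (intro conjI ballI allI impI)
  let ?\<rho> = "relabel_signed \<pi>"
  have inj': "?\<rho> C = ?\<rho> D \<longleftrightarrow> C = D" for C D
    using inj by (auto simp: relabel_signed_def inj_image_eq_iff prod_eq_iff)
  show "finite (\<pi> ` E)" using om by (simp add: oriented_matroid_def)
  show "({}, {}) \<notin> ?\<rho> ` \<C>"
    using om by (auto simp: oriented_matroid_def relabel_signed_def)
  fix C assume C: "C \<in> \<C>"
  note omC = oriented_matroidD[OF om C]
  show "fst (?\<rho> C) \<inter> snd (?\<rho> C) = {}"
    using omC(1) inj by (simp add: relabel_signed_def image_Int[symmetric])
  show "supp (?\<rho> C) \<subseteq> \<pi> ` E" using omC(2) by (auto simp: relabel_signed_simps)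
  show "opposite (?\<rho> C) \<in> ?\<rho> ` \<C>"
    using omC(3) by (simp add: relabel_signed_simps(2)[symmetric])
  fix D assume D: "D \<in> \<C>"
  show "?\<rho> C = ?\<rho> D \<or> ?\<rho> C = opposite (?\<rho> D)" if "supp (?\<rho> C) \<subseteq> supp (?\<rho> D)"
    using that omC(4)[OF D] inj by (auto simp: relabel_signed_simps inj_image_subset_iff)
  fix e assume e: "?\<rho> C \<noteq> opposite (?\<rho> D) \<and> e \<in> fst (?\<rho> C) \<inter> snd (?\<rho> D)"
  have ne: "C \<noteq> opposite D" using e by (auto simp: relabel_signed_simps)
  from e obtain e' where e': "e = \<pi> e'" "e' \<in> fst C \<inter> snd D"
    using inj by (auto simp: relabel_signed_def dest: injD)
  then obtain Z where Z: "Z \<in> \<C>" "fst Z \<subseteq> (fst C \<union> fst D) - {e'}" "snd Z \<subseteq> (snd C \<union> snd D) - {e'}"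
    using omC(5)[OF D ne] by blast
  have "fst (?\<rho> Z) \<subseteq> (fst (?\<rho> C) \<union> fst (?\<rho> D)) - {e} \<and> snd (?\<rho> Z) \<subseteq> (snd (?\<rho> C) \<union> snd (?\<rho> D)) - {e}"
    using Z(2,3) inj unfolding relabel_signed_def e'(1) by (auto dest: injD)
  thus "\<exists>Z\<in>?\<rho> ` \<C>. fst Z \<subseteq> (fst (?\<rho> C) \<union> fst (?\<rho> D)) - {e} \<and>
      snd Z \<subseteq> (snd (?\<rho> C) \<union> snd (?\<rho> D)) - {e}"
    using Z(1) by blast
qed

lemma oriented_matroid_restriction:
  assumes om: "oriented_matroid E \<C>" and sub: "E' \<subseteq> E"
  shows "oriented_matroid E' (restriction \<C> E')"
  unfolding oriented_matroid_def
proof (intro conjI ballI allI impI)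
  show "finite E'" using om sub finite_subset by (auto simp: oriented_matroid_def)
  show "({}, {}) \<notin> restriction \<C> E'" using om by (auto simp: oriented_matroid_def restriction_def)
  fix C assume "C \<in> restriction \<C> E'"
  hence C: "C \<in> \<C>" "supp C \<subseteq> E'" by (auto simp: restriction_def)
  note omC = oriented_matroidD[OF om C(1)]
  show "fst C \<inter> snd C = {}" by (rule omC)
  show "supp C \<subseteq> E'" by (rule C)
  show "opposite C \<in> restriction \<C> E'"
    using omC(3) C by (auto simp: restriction_def supp_def opposite_def)
  fix D assume "D \<in> restriction \<C> E'"
  hence D: "D \<in> \<C>" "supp D \<subseteq> E'" by (auto simp: restriction_def)
  show "C = D \<or> C = opposite D" if "supp C \<subseteq> supp D" using omC(4) D that by blast
  fix e assume "C \<noteq> opposite D \<and> e \<in> fst C \<inter> snd D"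
  then obtain Z where Z: "Z \<in> \<C>" "fst Z \<subseteq> (fst C \<union> fst D) - {e}" "snd Z \<subseteq> (snd C \<union> snd D) - {e}"
    using omC(5) D by blast
  hence "supp Z \<subseteq> E'" using C(2) D(2) by (auto simp: supp_def)
  thus "\<exists>Z\<in>restriction \<C> E'. fst Z \<subseteq> (fst C \<union> fst D) - {e} \<and> snd Z \<subseteq> (snd C \<union> snd D) - {e}"
    using Z unfolding restriction_def by (intro bexI[of _ Z]) simp_all
qed

lemma restriction_relabel_reorient:
  assumes "inj \<pi>"
  shows "relabel \<pi> (reorient F (restriction \<C> E)) = restriction (relabel \<pi> (reorient F \<C>)) (\<pi> ` E)"
proof -
  have "supp (relabel_signed \<pi> (reorient_signed F C)) \<subseteq> \<pi> ` E \<longleftrightarrow> supp C \<subseteq> E" for C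
    using assms by (simp add: relabel_signed_simps reorient_signed_simps inj_image_subset_iff)
  thus ?thesis unfolding relabel_eq reorient_eq restriction_def image_image by blast
qed

section \<open>The alternating matroid\<close>

lemma alternating_matroid_upt:
  "alternating_matroid [0..<N] r = {C. supp C \<subseteq> {..<N} \<and> card (supp C) = Suc r \<and> alternates C}"
  "alternating_matroid [0..<N] r = vector_circuits {..<N} r (\<lambda>i k. real i ^ k)"
proof -
  let ?A = "vector_circuits {..<N} r (\<lambda>i k. real i ^ k)"
  have A: "?A = {C. supp C \<subseteq> {..<N} \<and> card (supp C) = Suc r \<and> alternates C}"
    by (rule vector_circuits_moment_curve) (simp add: strict_mono_on_def)
  have "relabel_signed ((!) [0..<N]) C = C" if "supp C \<subseteq> {..<N}" for C
  proof -
    have "(!) [0..<N] ` X = X" if "X \<subseteq> {..<N}" for X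
      using that by (auto simp: subset_iff image_iff)
    thus ?thesis using that by (simp add: relabel_signed_def supp_def)
  qed
  hence "relabel_signed ((!) [0..<N]) ` ?A = ?A" unfolding A by (auto simp: image_iff)
  thus "alternating_matroid [0..<N] r = ?A"
    by (simp add: alternating_matroid_def relabel_eq)
  with A show "alternating_matroid [0..<N] r = {C. supp C \<subseteq> {..<N} \<and> card (supp C) = Suc r \<and> alternates C}"
    by simp
qed

lemma alternating_circuit_exists:
  assumes "S \<subseteq> {..<N}" "card S = Suc r"
  obtains C where "C \<in> alternating_matroid [0..<N] r" "supp C = S"
proof -
  have inj: "inj_on real {..<N}" by simp
  obtain c where c: "lin_dependence {..<N} r (\<lambda>i k. real i ^ k) c" "{e. c e \<noteq> 0} = S"
    using dependence_exists[OF inj assms] by blast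
  let ?C = "({e. c e > 0}, {e. c e < 0})"
  have "alternates ?C"
    by (rule dependence_alternates[OF c(1)]) (use c(2) assms in \<open>auto simp: strict_mono_on_def\<close>)
  moreover have "supp ?C = S" using c(2) by (auto simp: supp_def)
  ultimately show ?thesis using that[of ?C] assms by (simp add: alternating_matroid_upt)
qed

text \<open>Along the support the sign changes at every step, so two signs are compared by counting the
  steps between them.\<close>

lemma alternates_parity:
  fixes C :: "nat signed_set"
  assumes alt: "alternates C" and fin: "finite (supp C)"
    and ij: "i \<in> supp C" "j \<in> supp C" "i \<le> j"
  shows "(i \<in> fst C \<longleftrightarrow> j \<in> fst C) \<longleftrightarrow> even (card {k \<in> supp C. i < k \<and> k \<le> j})"
  using ij
proof (induction "j - i" arbitrary: i rule: less_induct)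
  case less
  show ?case
  proof (cases "i = j")
    case True
    hence empty: "{k \<in> supp C. i < k \<and> k \<le> j} = {}" by auto
    show ?thesis unfolding empty using True by simp
  next
    case False
    define k where "k = Min {k \<in> supp C. i < k}"
    have ne: "finite {k \<in> supp C. i < k}" "{k \<in> supp C. i < k} \<noteq> {}"
      using fin False less.prems by auto
    have k: "k \<in> supp C" "i < k" using Min_in[OF ne] by (auto simp: k_def)
    have kmin: "k \<le> l" if "l \<in> supp C" "i < l" for l
      unfolding k_def by (rule Min_le[OF ne(1)]) (use that in simp)
    have kj: "k \<le> j" using kmin False less.prems by simp
    have "{i<..<k} \<inter> supp C = {}" using kmin by fastforce
    hence "i \<in> fst C \<longleftrightarrow> k \<in> snd C"
      using alt less.prems(1) k by (auto simp: alternates_def)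
    moreover have "fst C \<inter> snd C = {}" using alt unfolding alternates_def by (rule conjunct1)
    hence "k \<in> snd C \<longleftrightarrow> k \<notin> fst C" using k(1) unfolding supp_def by blast
    moreover have "(k \<in> fst C \<longleftrightarrow> j \<in> fst C) \<longleftrightarrow> even (card {l \<in> supp C. k < l \<and> l \<le> j})"
      by (rule less.hyps) (use k kj less.prems in auto)
    moreover have "{l \<in> supp C. i < l \<and> l \<le> j} = insert k {l \<in> supp C. k < l \<and> l \<le> j}"
    proof (intro equalityI subsetI)
      fix l assume "l \<in> {l \<in> supp C. i < l \<and> l \<le> j}"
      thus "l \<in> insert k {l \<in> supp C. k < l \<and> l \<le> j}" using kmin[of l] by auto
    next
      fix l assume "l \<in> insert k {l \<in> supp C. k < l \<and> l \<le> j}"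
      thus "l \<in> {l \<in> supp C. i < l \<and> l \<le> j}" using k kj by auto
    qed
    hence "card {l \<in> supp C. i < l \<and> l \<le> j} = Suc (card {l \<in> supp C. k < l \<and> l \<le> j})"
      using fin by simp
    ultimately show ?thesis by auto
  qed
qed

section \<open>Bracket layouts of forest orders\<close>

text \<open>Room for two new values directly behind \<open>b\<close>.\<close>

lemma gap_above:
  fixes b :: real
  assumes "finite U"
  obtains t t' where "t < t'" "\<And>u. u \<in> U \<Longrightarrow> u \<le> b \<Longrightarrow> u < t" "\<And>u. u \<in> U \<Longrightarrow> b < u \<Longrightarrow> t' < u"
proof -
  define m where "m = Min (insert (b + 3) {u \<in> U. b < u})"
  have fin: "finite (insert (b + 3) {u \<in> U. b < u})" using assms by simp
  have "m \<in> insert (b + 3) {u \<in> U. b < u}" unfolding m_def by (rule Min_in) (use fin in auto)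
  hence m: "b < m" by auto
  have "m \<le> u" if "u \<in> U" "b < u" for u
    unfolding m_def by (rule Min_le[OF fin]) (use that in simp)
  thus ?thesis using m by (intro that[of "b + (m - b) / 3" "b + 2 * (m - b) / 3"]) (force simp: field_simps)+
qed

lemma rank_permutation:
  fixes f :: "nat \<Rightarrow> real"
  assumes inj: "inj_on f {..<N}"
  shows "\<exists>\<pi>. \<pi> permutes {..<N} \<and> (\<forall>i<N. \<forall>j<N. \<pi> i < \<pi> j \<longleftrightarrow> f i < f j)"
proof -
  define \<pi> where "\<pi> e = (if e < N then card {e'. e' < N \<and> f e' < f e} else e)" for e
  have less: "\<pi> i < \<pi> j" if "i < N" "j < N" "f i < f j" for i j
  proof -
    have "{e'. e' < N \<and> f e' < f i} \<subset> {e'. e' < N \<and> f e' < f j}" using that by auto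
    hence "card {e'. e' < N \<and> f e' < f i} < card {e'. e' < N \<and> f e' < f j}"
      by (intro psubset_card_mono) auto
    thus ?thesis using that by (simp add: \<pi>_def)
  qed
  have eq: "f i = f j \<longleftrightarrow> i = j" if "i < N" "j < N" for i j
    using inj that by (auto simp: inj_on_def)
  have iff: "\<pi> i < \<pi> j \<longleftrightarrow> f i < f j" if "i < N" "j < N" for i j
    using less[OF that] less[OF that(2,1)] eq[OF that] by (metis less_asym linorder_neqE not_less_iff_gr_or_eq)
  have "\<pi> e < N" if "e < N" for e
  proof -
    have "{e'. e' < N \<and> f e' < f e} \<subset> {..<N}" using that by auto
    hence "card {e'. e' < N \<and> f e' < f e} < card {..<N}" by (intro psubset_card_mono) auto
    thus ?thesis using that by (simp add: \<pi>_def)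
  qed
  moreover have "inj_on \<pi> {..<N}"
  proof (rule inj_onI)
    fix i j assume ij: "i \<in> {..<N}" "j \<in> {..<N}" "\<pi> i = \<pi> j"
    hence "\<not> f i < f j" "\<not> f j < f i" using less[of i j] less[of j i] by fastforce+
    thus "i = j" using eq[of i j] ij by simp
  qed
  ultimately have "\<pi> ` {..<N} = {..<N}"
    by (intro card_subset_eq) (auto simp: card_image)
  hence "bij_betw \<pi> {..<N} {..<N}" using \<open>inj_on \<pi> {..<N}\<close> by (simp add: bij_betw_def)
  hence "\<pi> permutes {..<N}" by (rule bij_imp_permutes) (simp add: \<pi>_def)
  thus ?thesis using iff by blast
qed

context forest
begin

text \<open>Element \<open>i\<close> is the opening and \<open>i + n\<close> the closing bracket of node \<open>i\<close>; the brackets of a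
  descendant lie inside those of its ancestors, and incomparable nodes have disjoint brackets. The
  layout takes values in any linear order: real values leave room for insertions, and positions
  \<open>0, \<dots>, 2n - 1\<close> are needed at the end.\<close>

definition bracket_layout :: "(nat \<Rightarrow> 'a::linorder) \<Rightarrow> nat set \<Rightarrow> bool" where
  "bracket_layout g S \<longleftrightarrow>
     inj_on g (S \<union> (\<lambda>i. i + n) ` S) \<and> (\<forall>i\<in>S. g i < g (i + n)) \<and>
     (\<forall>i\<in>S. \<forall>j\<in>S. (i, j) \<in> E \<longrightarrow> i \<noteq> j \<longrightarrow> g i < g j \<and> g (j + n) < g (i + n)) \<and>
     (\<forall>i\<in>S. \<forall>j\<in>S. (i, j) \<notin> E \<longrightarrow> (j, i) \<notin> E \<longrightarrow> g (i + n) < g j \<or> g (j + n) < g i)"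

lemma bracket_layoutD:
  assumes "bracket_layout g S" "i \<in> S" "j \<in> S"
  shows "g i < g (i + n)"
    "(i, j) \<in> E \<Longrightarrow> i \<noteq> j \<Longrightarrow> g i < g j \<and> g (j + n) < g (i + n)"
    "(i, j) \<notin> E \<Longrightarrow> (j, i) \<notin> E \<Longrightarrow> g (i + n) < g j \<or> g (j + n) < g i"
  using assms unfolding bracket_layout_def by auto

text \<open>A new leaf goes directly behind the opening bracket of its parent, or in front of everything if
  it is a root. Exactly the brackets of its ancestors are open there.\<close>

lemma bracket_layout_insert:
  fixes g :: "nat \<Rightarrow> real"
  assumes g: "bracket_layout g S" and S: "S \<subseteq> {..<n}" and x: "x < n" "x \<notin> S"
    and top: "\<And>y. y \<in> S \<Longrightarrow> (x, y) \<notin> E"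
  shows "\<exists>g' :: nat \<Rightarrow> real. bracket_layout g' (insert x S)"
proof -
  have finS: "finite S" using S finite_subset by blast
  let ?U = "S \<union> (\<lambda>i. i + n) ` S"
  define A where "A = strict_ancestors_in S x"
  have A: "a \<in> A \<longleftrightarrow> a \<in> S \<and> (a, x) \<in> E" for a
    using x(2) by (auto simp: A_def strict_ancestors_in_def)
  \<comment> \<open>The threshold \<open>b\<close> is the opening bracket of the parent of \<open>x\<close> in \<open>S\<close>, or lies below
    everything if there is none; the pair of \<open>x\<close> goes right behind it.\<close>
  obtain b where b: "\<And>a. a \<in> A \<Longrightarrow> g a \<le> b \<and> b < g (a + n)"
    "\<And>i. i \<in> S \<Longrightarrow> i \<notin> A \<Longrightarrow> g (i + n) \<le> b \<or> b < g i"
  proof (cases "A = {}")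
    case True
    define b where "b = Min (insert 0 (g ` ?U)) - 1"
    have "b < g i" if "i \<in> S" for i
    proof -
      have "Min (insert 0 (g ` ?U)) \<le> g i" by (rule Min_le) (use finS that in auto)
      thus ?thesis by (simp add: b_def)
    qed
    thus ?thesis using that[of b] True by blast
  next
    case False
    obtain p where p: "p \<in> A" "\<And>a. a \<in> A \<Longrightarrow> height a \<le> height p"
    proof -
      have fin: "finite (height ` A)" using finite_strict_ancestors_in by (simp add: A_def)
      have "Max (height ` A) \<in> height ` A" using fin False by (intro Max_in) auto
      then obtain p where "p \<in> A" "height p = Max (height ` A)" by auto
      thus ?thesis using that Max_ge[OF fin] by auto
    qed
    have pS: "p \<in> S" "(p, x) \<in> E" using p(1) A by auto
    have anc: "(a, p) \<in> E" if "a \<in> A" for a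
      using forestD(6)[of a x p] A that pS p(2)[OF that] height_less[of p a] forestD(3)[of p] S
      by (metis leD lessThan_iff subsetD)
    show ?thesis
    proof (rule that[of "g p"])
      fix a assume a: "a \<in> A"
      hence "a \<in> S" using A by simp
      show "g a \<le> g p \<and> g p < g (a + n)"
      proof (cases "a = p")
        case True
        thus ?thesis using bracket_layoutD(1)[OF g pS(1) pS(1)] by simp
      next
        case False
        thus ?thesis
          using bracket_layoutD(1)[OF g pS(1) pS(1)] bracket_layoutD(2)[OF g \<open>a \<in> S\<close> pS(1) anc[OF a]]
          by simp
      qed
    next
      fix i assume i: "i \<in> S" "i \<notin> A"
      have "(i, p) \<notin> E" using i A forestD(4) pS by blast
      moreover have "i \<noteq> p" using i p by auto
      ultimately show "g (i + n) \<le> g p \<or> g p < g i"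
        using bracket_layoutD(2)[OF g pS(1) i(1)] bracket_layoutD(3)[OF g pS(1) i(1)]
          bracket_layoutD(1)[OF g pS(1) pS(1)]
        by (cases "(p, i) \<in> E") force+
    qed
  qed
  obtain t t' where t: "t < t'" "\<And>u. u \<in> ?U \<Longrightarrow> g u \<le> b \<Longrightarrow> g u < t" "\<And>u. u \<in> ?U \<Longrightarrow> b < g u \<Longrightarrow> t' < g u"
    using gap_above[of "g ` ?U" b] finS by (metis finite_Un finite_imageI image_eqI)
  define g' where "g' = g(x := t, x + n := t')"
  have xU: "x \<notin> ?U" "x + n \<notin> ?U" using x S by auto
  have n0: "n \<noteq> 0" using x(1) by auto
  have old: "g' u = g u" if "u \<in> ?U" for u using that xU by (auto simp: g'_def)
  have new: "g' x = t" "g' (x + n) = t'" using n0 by (auto simp: g'_def)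
  have oldS: "g' i = g i" "g' (i + n) = g (i + n)" if "i \<in> S" for i using that old by auto
  have ne: "g u \<noteq> t \<and> g u \<noteq> t'" if "u \<in> ?U" for u
    using t(1) t(2)[OF that] t(3)[OF that] by (cases "g u \<le> b") auto
  have "inj_on g' (insert x (insert (x + n) ?U))"
  proof -
    have "inj_on g ?U" using g by (simp add: bracket_layout_def)
    hence "inj_on g' ?U" by (subst inj_on_cong[OF old])
    moreover have nt: "g' u \<noteq> t" "g' u \<noteq> t'" if "u \<in> ?U" for u
      using ne[OF that] by (simp_all add: old[OF that])
    have "t \<notin> g' ` ?U" "t' \<notin> g' ` ?U"
      using nt by (metis (no_types, lifting) imageE)+
    moreover have "?U - {x} = ?U" "?U - {x + n} = ?U" using xU by blast+
    ultimately show ?thesis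
      using new t(1) n0 by (simp add: inj_on_insert insert_Diff_if del: Un_iff image_Un)
  qed
  hence inj: "inj_on g' (insert x S \<union> (\<lambda>i. i + n) ` insert x S)"
    by (rule inj_on_subset) auto
  have anc: "g a < t \<and> t' < g (a + n)" if "a \<in> A" for a
    using that A b(1)[OF that] t(2)[of a] t(3)[of "a + n"] by auto
  have dis: "g (i + n) < t \<or> t' < g i" if "i \<in> S" "i \<notin> A" for i
    using that b(2)[OF that] t(2)[of "i + n"] t(3)[of i] by auto
  have "bracket_layout g' (insert x S)"
    unfolding bracket_layout_def
  proof (intro conjI ballI impI)
    show "inj_on g' (insert x S \<union> (\<lambda>i. i + n) ` insert x S)" by (rule inj)
    fix i assume i: "i \<in> insert x S"
    show "g' i < g' (i + n)"
      using i new oldS[of i] bracket_layoutD(1)[OF g, of i i] t(1) by (cases "i = x") auto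
    fix j assume j: "j \<in> insert x S"
    { assume ij: "(i, j) \<in> E" "i \<noteq> j"
      have "i \<noteq> x" using ij j top by auto
      hence iS: "i \<in> S" using i by simp
      have "g' i < g' j \<and> g' (j + n) < g' (i + n)"
        using ij j new oldS iS anc[of i] A[of i] bracket_layoutD(2)[OF g iS, of j]
        by (cases "j = x") auto
      thus "g' i < g' j" "g' (j + n) < g' (i + n)" by auto }
    { assume ij: "(i, j) \<notin> E" "(j, i) \<notin> E"
      have "\<not> (i = x \<and> j = x)" using ij forestD(3)[OF x(1)] by auto
      then consider "i = x" "j \<in> S" | "j = x" "i \<in> S" | "i \<in> S" "j \<in> S" using i j by blast
      thus "g' (i + n) < g' j \<or> g' (j + n) < g' i"
      proof cases
        case 1
        thus ?thesis using dis[of j] A[of j] ij new oldS[of j] by auto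
      next
        case 2
        thus ?thesis using dis[of i] A[of i] ij new oldS[of i] by auto
      next
        case 3
        thus ?thesis using bracket_layoutD(3)[OF g 3 ij] oldS by simp
      qed }
  qed
  thus ?thesis by blast
qed

text \<open>Inserting the nodes by increasing height guarantees that every new node is a leaf.\<close>

lemma bracket_layout_exists:
  assumes "S \<subseteq> {..<n}"
  shows "\<exists>g :: nat \<Rightarrow> real. bracket_layout g S"
proof -
  have "finite S" using assms finite_subset by blast
  thus ?thesis using assms
  proof (induction S rule: finite_ranking_induct[where f = height])
    case empty
    thus ?case by (simp add: bracket_layout_def)
  next
    case (insert x S)
    show ?case
    proof (cases "x \<in> S")
      case True
      thus ?thesis using insert.IH insert.prems by (simp add: insert_absorb)
    next
      case False
      have "(x, y) \<notin> E" if "y \<in> S" for y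
        using insert.hyps(2)[OF that] height_less[of x y] that False by fastforce
      moreover obtain g :: "nat \<Rightarrow> real" where "bracket_layout g S" using insert by auto
      ultimately show ?thesis using bracket_layout_insert[of g S x] insert.prems False by auto
    qed
  qed
qed

lemma layout_permutation_exists:
  obtains \<pi> where "\<pi> permutes {..<2*n}" "bracket_layout \<pi> {..<n}"
proof -
  obtain g :: "nat \<Rightarrow> real" where g: "bracket_layout g {..<n}" using bracket_layout_exists by blast
  have ground: "{..<n} \<union> (\<lambda>i. i + n) ` {..<n} = {..<2*n}"
  proof (intro equalityI subsetI)
    fix e assume "e \<in> {..<2*n}"
    thus "e \<in> {..<n} \<union> (\<lambda>i. i + n) ` {..<n}"
      by (cases "e < n") (auto intro!: image_eqI[of _ _ "e - n"])
  qed auto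
  hence "inj_on g {..<2*n}" using g by (simp add: bracket_layout_def)
  then obtain \<pi> where p: "\<pi> permutes {..<2*n}"
    "\<And>i j. i < 2*n \<Longrightarrow> j < 2*n \<Longrightarrow> \<pi> i < \<pi> j \<longleftrightarrow> g i < g j"
    using rank_permutation by blast
  have "inj_on \<pi> ({..<n} \<union> (\<lambda>i. i + n) ` {..<n})" using permutes_inj_on[OF p(1)] .
  hence "bracket_layout \<pi> {..<n}" using g by (auto simp: bracket_layout_def p(2))
  thus ?thesis using that p(1) by blast
qed

end

section \<open>The cyclic-P-matroid of a bracket layout and its extension\<close>

locale forest_layout = forest +
  fixes \<pi> :: "nat \<Rightarrow> nat"
  assumes perm: "\<pi> permutes {..<2*n}" and layout: "bracket_layout \<pi> {..<n}"
begin

lemma inj_\<pi>: "inj \<pi>"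
  using permutes_inj[OF perm] .

lemma \<pi>_eq_iff: "\<pi> a = \<pi> b \<longleftrightarrow> a = b"
  using inj_\<pi> by (auto simp: inj_def)

lemma \<pi>_q: "\<pi> (2*n) = 2*n"
  using perm by (simp add: permutes_not_in)

lemma \<pi>_less: "\<pi> e < 2*n \<longleftrightarrow> e < 2*n"
  using permutes_in_image[OF perm, of e] by simp

lemma \<pi>_image: "\<pi> ` {..<2*n} = {..<2*n}" "\<pi> ` {..<Suc (2*n)} = {..<Suc (2*n)}"
  using permutes_image[OF perm] \<pi>_q by (simp_all add: lessThan_Suc)

lemma inv_\<pi>: "\<pi> (inv_into UNIV \<pi> e) = e" "inv_into UNIV \<pi> (\<pi> e) = e" "inj (inv_into UNIV \<pi>)"
  using permutes_inverses[OF perm] permutes_inj[OF permutes_inv[OF perm]] by simp_all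

lemma layoutD:
  assumes "i < n" "j < n"
  shows "\<pi> i < \<pi> (i + n)"
    "(i, j) \<in> E \<Longrightarrow> i \<noteq> j \<Longrightarrow> \<pi> i < \<pi> j \<and> \<pi> (j + n) < \<pi> (i + n)"
    "(i, j) \<notin> E \<Longrightarrow> (j, i) \<notin> E \<Longrightarrow> \<pi> (i + n) < \<pi> j \<or> \<pi> (j + n) < \<pi> i"
  using bracket_layoutD[OF layout, of i j] assms by simp_all

text \<open>Both brackets of \<open>j\<close> lie on the same side of each bracket of \<open>i\<close>, unless \<open>j\<close> encloses \<open>i\<close>; in that
  case neither of them lies between the brackets of \<open>i\<close>.\<close>

lemma inside_iff:
  assumes "i < n" "j < n" "j \<noteq> i"
  shows "\<pi> i < \<pi> (j + n) \<and> \<pi> (j + n) < \<pi> (i + n) \<longleftrightarrow> \<pi> i < \<pi> j \<and> \<pi> j < \<pi> (i + n)"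
  using layoutD[OF assms(1,2)] layoutD[OF assms(2,1)] assms(3)
  by (cases "(i, j) \<in> E"; cases "(j, i) \<in> E") auto

definition openings_after :: "nat \<Rightarrow> nat" where
  "openings_after e = card {j. j < n \<and> \<pi> e < \<pi> j}"

text \<open>The reorientation is dictated by the wish that \<open>m {} = {}\<close>. For the basis \<open>{..<n}\<close> the element
  \<open>i\<close> is followed by \<open>openings_after i\<close> chosen elements and then by \<open>q\<close>, which is positive; so
  its sign in the alternating circuit has to be flipped precisely if that number is even. The
  element \<open>i + n\<close> gets the choice that makes it produce the opposite answer.\<close>

definition flips :: "nat set" where
  "flips = {e. e < 2*n \<and> (e < n \<longleftrightarrow> even (openings_after e))}"

text \<open>The alternating matroid on \<open>{..2 * n}\<close>, pulled back along \<open>\<pi>\<close> and then reoriented. The last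
  element \<open>2 * n\<close>, in the role of \<open>q\<close>, stays in place.\<close>

definition circuits :: "nat signed_set set" where
  "circuits = reorient flips (relabel (inv_into UNIV \<pi>) (alternating_matroid [0..<Suc (2*n)] n))"

lemma relabel_reorient_circuits:
  "relabel \<pi> (reorient flips circuits) = alternating_matroid [0..<Suc (2*n)] n"
proof -
  have "relabel_signed \<pi> (relabel_signed (inv_into UNIV \<pi>) C) = C" for C
    by (simp add: relabel_signed_def image_image inv_\<pi>)
  thus ?thesis
    by (simp add: circuits_def relabel_eq reorient_eq image_image reorient_signed_simps)
qed

lemma oriented_matroid_circuits: "oriented_matroid {..2*n} circuits"
proof -
  have "inv_into UNIV \<pi> ` {..<Suc (2*n)} = inv_into UNIV \<pi> ` \<pi> ` {..<Suc (2*n)}" by (simp add: \<pi>_image)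
  also have "\<dots> = {..<Suc (2*n)}" by (simp only: image_image inv_\<pi> image_ident)
  finally show ?thesis
    using oriented_matroid_reorient[OF oriented_matroid_relabel[OF oriented_matroid_vector_circuits inv_\<pi>(3)],
        of "{..<Suc (2*n)}" flips n "\<lambda>i k. real i ^ k"]
    by (simp add: circuits_def alternating_matroid_upt(2) lessThan_Suc_atMost del: upt_Suc)
qed

text \<open>The last statement is what replaces alternation after relabelling and reorienting: signs are
  compared by the number of elements in between, counted by position, corrected by the flips.\<close>

lemma circuitD:
  assumes C: "C \<in> circuits"
  shows "supp C \<subseteq> {..2*n}" "card (supp C) = Suc n"
    "fst C \<inter> snd C = {}"
    "a \<in> supp C \<Longrightarrow> b \<in> supp C \<Longrightarrow> \<pi> a \<le> \<pi> b \<Longrightarrow>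
      (a \<in> fst C \<longleftrightarrow> b \<in> fst C) \<longleftrightarrow>
      (even (card {f \<in> supp C. \<pi> a < \<pi> f \<and> \<pi> f \<le> \<pi> b}) \<longleftrightarrow> (a \<in> flips \<longleftrightarrow> b \<in> flips))"
proof -
  show sub: "supp C \<subseteq> {..2*n}" and disj: "fst C \<inter> snd C = {}"
    using oriented_matroidD[OF oriented_matroid_circuits C] by simp_all
  define A where "A = relabel_signed \<pi> (reorient_signed flips C)"
  have "A \<in> alternating_matroid [0..<Suc (2*n)] n"
    using C unfolding relabel_reorient_circuits[symmetric] A_def relabel_eq reorient_eq by blast
  hence alt: "alternates A" and card: "card (supp A) = Suc n"
    unfolding alternating_matroid_upt(1) by auto
  have supp: "supp A = \<pi> ` supp C" by (simp add: A_def relabel_signed_simps reorient_signed_simps)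
  show "card (supp C) = Suc n"
    using card card_image[OF inj_on_subset[OF inj_\<pi> subset_UNIV], of "supp C"] by (simp add: supp)
  have sign: "\<pi> e \<in> fst A \<longleftrightarrow> (e \<in> fst C \<longleftrightarrow> e \<notin> flips)" if "e \<in> supp C" for e
    using that disj
    by (auto simp: A_def relabel_signed_def reorient_signed_def supp_def inj_image_mem_iff[OF inj_\<pi>])
  assume ab: "a \<in> supp C" "b \<in> supp C" "\<pi> a \<le> \<pi> b"
  have "finite (supp A)" using card by (intro card_ge_0_finite) simp
  hence "(\<pi> a \<in> fst A \<longleftrightarrow> \<pi> b \<in> fst A) \<longleftrightarrow> even (card {k \<in> supp A. \<pi> a < k \<and> k \<le> \<pi> b})"
    using alternates_parity[OF alt] ab by (simp add: supp)
  moreover have "{k \<in> supp A. \<pi> a < k \<and> k \<le> \<pi> b} = \<pi> ` {f \<in> supp C. \<pi> a < \<pi> f \<and> \<pi> f \<le> \<pi> b}"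
    by (auto simp: supp)
  hence "card {k \<in> supp A. \<pi> a < k \<and> k \<le> \<pi> b} = card {f \<in> supp C. \<pi> a < \<pi> f \<and> \<pi> f \<le> \<pi> b}"
    by (simp add: card_image[OF inj_on_subset[OF inj_\<pi> subset_UNIV]])
  ultimately show "(a \<in> fst C \<longleftrightarrow> b \<in> fst C) \<longleftrightarrow>
      (even (card {f \<in> supp C. \<pi> a < \<pi> f \<and> \<pi> f \<le> \<pi> b}) \<longleftrightarrow> (a \<in> flips \<longleftrightarrow> b \<in> flips))"
    using sign ab by auto
qed

lemma circuit_exists:
  assumes S: "S \<subseteq> {..2*n}" "card S = Suc n"
  obtains C where "C \<in> circuits" "supp C = S"
proof -
  have "\<pi> ` S \<subseteq> {..<Suc (2*n)}" using S(1) \<pi>_image(2) by (auto simp: lessThan_Suc_atMost)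
  moreover have "card (\<pi> ` S) = Suc n"
    using S(2) by (simp add: card_image[OF inj_on_subset[OF inj_\<pi> subset_UNIV]])
  ultimately obtain A where A: "A \<in> alternating_matroid [0..<Suc (2*n)] n" "supp A = \<pi> ` S"
    by (rule alternating_circuit_exists)
  let ?C = "reorient_signed flips (relabel_signed (inv_into UNIV \<pi>) A)"
  have "?C \<in> circuits" using A(1) by (auto simp: circuits_def relabel_eq reorient_eq)
  moreover have "supp ?C = S"
    by (simp add: reorient_signed_simps relabel_signed_simps A(2) image_image inv_\<pi>)
  ultimately show ?thesis by (rule that)
qed

definition dimension :: "nat \<Rightarrow> nat" where
  "dimension e = (if e < n then e else e - n)"

text \<open>By counting: there are \<open>n\<close> elements, at most one from each of the \<open>n\<close> pairs.\<close>

lemma transversal: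
  assumes T: "T \<subseteq> {..<2*n}" "card T = n"
    and tr: "\<And>j. j < n \<Longrightarrow> j \<in> T \<Longrightarrow> j + n \<notin> T"
  shows "inj_on dimension T" "dimension ` T = {..<n}"
proof -
  show inj: "inj_on dimension T"
  proof (rule inj_onI)
    fix a b assume ab: "a \<in> T" "b \<in> T" "dimension a = dimension b"
    show "a = b"
      using ab tr[of a] tr[of b] by (cases "a < n"; cases "b < n") (auto simp: dimension_def)
  qed
  have "dimension ` T \<subseteq> {..<n}" using T(1) by (auto simp: dimension_def)
  moreover have "card (dimension ` T) = n" using T(2) by (simp add: card_image[OF inj])
  ultimately show "dimension ` T = {..<n}" by (simp add: card_subset_eq)
qed

lemma basis_circuits:
  assumes B: "B \<subseteq> {..<2*n}" "card B = n"
  shows "om_basis {..<2*n} (restriction circuits {..<2*n}) B"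
  unfolding om_basis_def om_independent_def
proof (intro conjI allI impI)
  have finB: "finite B" using B(1) finite_subset by blast
  show "B \<subseteq> {..<2*n}" by (rule B)
  show "\<not> (\<exists>C\<in>restriction circuits {..<2*n}. supp C \<subseteq> B)"
  proof
    assume "\<exists>C\<in>restriction circuits {..<2*n}. supp C \<subseteq> B"
    then obtain C where C: "C \<in> circuits" "supp C \<subseteq> B" by (auto simp: restriction_def)
    have "card (supp C) \<le> card B" by (rule card_mono[OF finB C(2)])
    thus False using circuitD(2)[OF C(1)] B(2) by simp
  qed
  fix X assume X: "(X \<subseteq> {..<2*n} \<and> \<not> (\<exists>C\<in>restriction circuits {..<2*n}. supp C \<subseteq> X)) \<and> B \<subseteq> X"
  show "X = B"
  proof (rule ccontr)
    assume "X \<noteq> B"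
    then obtain x where x: "x \<in> X" "x \<notin> B" using X by blast
    have "insert x B \<subseteq> {..2*n}" using x X B(1) by auto
    moreover have "card (insert x B) = Suc n" using x(2) finB B(2) by simp
    ultimately obtain C where C: "C \<in> circuits" "supp C = insert x B" by (rule circuit_exists)
    have "C \<in> restriction circuits {..<2*n}" using C x X by (auto simp: restriction_def)
    moreover have "supp C \<subseteq> X" using C(2) x(1) X by simp
    ultimately show False using X by blast
  qed
qed

text \<open>This is the defining property of a P-matroid. Apart from the pair of \<open>i\<close>, the circuit takes one
  element of each pair, and such an element lies between \<open>i\<close> and \<open>i + n\<close> iff the opening bracket of
  its pair does. So the number of elements in between is \<open>openings_after i - openings_after (i + n)\<close>,
  whose parity the flips at \<open>i\<close> and \<open>i + n\<close> compensate.\<close>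

lemma same_sign_on_unique_pair:
  assumes C: "C \<in> circuits" "supp C \<subseteq> {..<2*n}" and i: "i < n" "i \<in> supp C" "i + n \<in> supp C"
    and uniq: "\<And>j. j < n \<Longrightarrow> j \<in> supp C \<Longrightarrow> j + n \<in> supp C \<Longrightarrow> j = i"
  shows "i \<in> fst C \<longleftrightarrow> i + n \<in> fst C"
proof -
  define T where "T = supp C - {i + n}"
  have finC: "finite (supp C)" using C(2) finite_subset by blast
  have T: "T \<subseteq> {..<2*n}" "card T = n"
    using C i(3) circuitD(2)[OF C(1)] finC by (auto simp: T_def)
  have tr: "j + n \<notin> T" if "j < n" "j \<in> T" for j
    using uniq[of j] that by (auto simp: T_def)
  note bij = transversal[OF T tr]
  let ?P = "\<lambda>f. \<pi> i < \<pi> f \<and> \<pi> f < \<pi> (i + n)"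
  have P: "?P f \<longleftrightarrow> ?P (dimension f)" if "f \<in> T" for f
  proof (cases "f < n")
    case False
    hence "f = (f - n) + n" "f - n < n" "f - n \<noteq> i"
      using that T(1) by (auto simp: T_def)
    thus ?thesis using inside_iff[OF i(1), of "f - n"] by (simp add: dimension_def)
  qed (simp add: dimension_def)
  have "dimension ` {f \<in> T. ?P f} = {j. j < n \<and> ?P j}"
  proof -
    have "dimension ` {f \<in> T. ?P f} = {j \<in> dimension ` T. ?P j}" using P by blast
    thus ?thesis using bij(2) by auto
  qed
  hence card_in: "card {f \<in> T. ?P f} = card {j. j < n \<and> ?P j}"
    using card_image[OF inj_on_subset[OF bij(1)], of "{f \<in> T. ?P f}"] by auto
  have "{f \<in> supp C. \<pi> i < \<pi> f \<and> \<pi> f \<le> \<pi> (i + n)} = insert (i + n) {f \<in> T. ?P f}"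
    using i layoutD(1)[OF i(1) i(1)] by (auto simp: T_def \<pi>_eq_iff le_less)
  moreover have "i + n \<notin> {f \<in> T. ?P f}" "finite {f \<in> T. ?P f}" using finC by (auto simp: T_def)
  ultimately have card_C: "card {f \<in> supp C. \<pi> i < \<pi> f \<and> \<pi> f \<le> \<pi> (i + n)} = Suc (card {j. j < n \<and> ?P j})"
    using card_in by simp
  have "{j. j < n \<and> \<pi> i < \<pi> j} = {j. j < n \<and> ?P j} \<union> {j. j < n \<and> \<pi> (i + n) < \<pi> j}"
    using layoutD(1)[OF i(1) i(1)] i(1) \<pi>_eq_iff by (auto simp: not_less_iff_gr_or_eq)
  moreover have "{j. j < n \<and> ?P j} \<inter> {j. j < n \<and> \<pi> (i + n) < \<pi> j} = {}" by auto
  ultimately have "openings_after i = card {j. j < n \<and> ?P j} + openings_after (i + n)"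
    unfolding openings_after_def by (simp add: card_Un_disjoint)
  moreover have "i \<in> flips \<longleftrightarrow> even (openings_after i)" "i + n \<in> flips \<longleftrightarrow> odd (openings_after (i + n))"
    using i(1) by (auto simp: flips_def)
  ultimately show ?thesis
    using circuitD(4)[OF C(1) i(2,3)] layoutD(1)[OF i(1) i(1)] card_C by auto
qed

lemma P_matroid_circuits: "P_matroid n (restriction circuits {..<2*n})"
  unfolding P_matroid_def
proof (intro conjI allI impI)
  show "oriented_matroid {..<2*n} (restriction circuits {..<2*n})"
    by (rule oriented_matroid_restriction[OF oriented_matroid_circuits]) auto
  show "om_basis {..<2*n} (restriction circuits {..<2*n}) {..<n}"
    by (rule basis_circuits) auto
  show "om_basis {..<2*n} (restriction circuits {..<2*n}) B"
    if "B \<subseteq> {..<2*n} \<and> card B = n \<and> \<not> (\<exists>e\<in>B. complement n e \<in> B)" for B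
    using that by (intro basis_circuits) auto
  show "\<not> (\<exists>C\<in>restriction circuits {..<2*n}. \<exists>e<2*n. e \<in> fst C \<and> complement n e \<in> snd C \<and>
      (\<forall>f<2*n. f \<in> supp C \<and> complement n f \<in> supp C \<longrightarrow> f = e \<or> f = complement n e))"
  proof
    assume "\<exists>C\<in>restriction circuits {..<2*n}. \<exists>e<2*n. e \<in> fst C \<and> complement n e \<in> snd C \<and>
      (\<forall>f<2*n. f \<in> supp C \<and> complement n f \<in> supp C \<longrightarrow> f = e \<or> f = complement n e)"
    then obtain C e where C: "C \<in> circuits" "supp C \<subseteq> {..<2*n}" and e: "e < 2*n" "e \<in> fst C"
      "complement n e \<in> snd C"
      and u: "\<And>f. f < 2*n \<Longrightarrow> f \<in> supp C \<Longrightarrow> complement n f \<in> supp C \<Longrightarrow> f = e \<or> f = complement n e"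
      unfolding restriction_def by blast
    define i where "i = dimension e"
    have i: "i < n" "e = i \<and> complement n e = i + n \<or> e = i + n \<and> complement n e = i"
      using e(1) by (auto simp: i_def dimension_def complement_def)
    have supp: "e \<in> supp C" "complement n e \<in> supp C" using e by (auto simp: supp_def)
    have disj: "complement n e \<notin> fst C" using e(3) circuitD(3)[OF C(1)] by blast
    have "i \<in> fst C \<longleftrightarrow> i + n \<in> fst C"
    proof (rule same_sign_on_unique_pair[OF C i(1)])
      show "i \<in> supp C" "i + n \<in> supp C" using i(2) supp by auto
      fix j assume j: "j < n" "j \<in> supp C" "j + n \<in> supp C"
      hence "j = e \<or> j = complement n e" using u[of j] by (simp add: complement_def)
      thus "j = i" using i j(1) by auto
    qed
    thus False using i(2) e(2) disj by auto
  qed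
qed

lemma simple_extension_circuits: "simple_extension_via n (2*n) \<pi> flips circuits"
proof -
  have flips: "flips \<subseteq> {..<2*n}" by (auto simp: flips_def)
  have "\<pi> permutes {..2*n}" using perm by (rule permutes_subset) auto
  moreover have "extended_order n (2*n) = [0..<Suc (2*n)]" by (simp add: extended_order_def)
  moreover have "cyclic_P_matroid_via n \<pi> (flips \<inter> {..<2*n}) (restriction circuits {..<2*n})"
  proof -
    have "relabel \<pi> (reorient flips (restriction circuits {..<2*n})) =
        restriction (alternating_matroid [0..<Suc (2*n)] n) {..<2*n}"
      by (simp add: restriction_relabel_reorient[OF inj_\<pi>] relabel_reorient_circuits \<pi>_image(1))
    also have "\<dots> = alternating_matroid [0..<2*n] n"
      unfolding alternating_matroid_upt(1) restriction_def by auto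
    finally show ?thesis
      unfolding cyclic_P_matroid_via_def using P_matroid_circuits perm flips
      by (simp add: Int_absorb2)
  qed
  ultimately show ?thesis
    unfolding simple_extension_via_def
    using oriented_matroid_circuits \<pi>_q flips relabel_reorient_circuits by auto
qed

text \<open>The element of pair \<open>j\<close> in the basis that belongs to the vertex \<open>v\<close>.\<close>

definition choice :: "nat set \<Rightarrow> nat \<Rightarrow> nat" where
  "choice v j = (if j \<in> v then j + n else j)"

text \<open>Only for the strict ancestors \<open>j\<close> of \<open>i\<close> does the choice in pair \<open>j\<close> decide whether its element
  comes behind that of pair \<open>i\<close>. It does so precisely if the closing bracket is chosen, that is, if
  \<open>j \<in> v\<close>.\<close>

lemma choice_before_choice_iff:
  assumes ij: "i < n" "j < n"
  shows "\<pi> (choice v i) < \<pi> (choice v j) \<longleftrightarrow>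
    \<pi> (choice v i) < \<pi> j \<or> j \<in> strict_ancestors_in v i"
    "j \<in> strict_ancestors_in v i \<Longrightarrow> \<not> \<pi> (choice v i) < \<pi> j"
proof -
  note ii = layoutD(1)[OF ij(1) ij(1)] and jj = layoutD(1)[OF ij(2) ij(2)]
  note L = layoutD(2,3)[OF ij] layoutD(2,3)[OF ij(2,1)]
  show "\<pi> (choice v i) < \<pi> (choice v j) \<longleftrightarrow>
    \<pi> (choice v i) < \<pi> j \<or> j \<in> strict_ancestors_in v i"
  proof (cases "i = j")
    case True
    thus ?thesis using ii by (auto simp: choice_def strict_ancestors_in_def)
  next
    case ne: False
    show ?thesis
      using ne ii jj L by (cases "(i, j) \<in> E"; cases "(j, i) \<in> E")
        (auto simp: choice_def strict_ancestors_in_def)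
  qed
  show "\<not> \<pi> (choice v i) < \<pi> j" if "j \<in> strict_ancestors_in v i"
    using that ii jj L by (auto simp: choice_def strict_ancestors_in_def)
qed

lemma card_choices_behind:
  assumes i: "i < n" and v: "v \<subseteq> {..<n}"
  shows "card {j. j < n \<and> \<pi> (choice v i) < \<pi> (choice v j)} =
    openings_after (choice v i) + card (strict_ancestors_in v i)"
proof -
  have "{j. j < n \<and> \<pi> (choice v i) < \<pi> (choice v j)} =
      {j. j < n \<and> \<pi> (choice v i) < \<pi> j} \<union> strict_ancestors_in v i"
    using choice_before_choice_iff(1)[OF i] v by (auto simp: strict_ancestors_in_def)
  moreover have "{j. j < n \<and> \<pi> (choice v i) < \<pi> j} \<inter> strict_ancestors_in v i = {}"
    using choice_before_choice_iff(2)[OF i] by auto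
  ultimately show ?thesis
    by (simp add: openings_after_def card_Un_disjoint finite_strict_ancestors_in)
qed

lemma fundamental_circuit_circuits:
  assumes v: "v \<subseteq> {..<n}"
  defines "C \<equiv> fundamental_circuit circuits (({..<n} - v) \<union> (\<lambda>i. i + n) ` v) (2*n)"
  shows "C \<in> circuits" "2*n \<in> fst C" "supp C = insert (2*n) (choice v ` {..<n})"
proof -
  have B: "({..<n} - v) \<union> (\<lambda>i. i + n) ` v = choice v ` {..<n}"
    using v by (auto simp: choice_def image_iff)
  have inj: "inj_on (choice v) {..<n}"
    by (rule inj_onI) (auto simp: choice_def split: if_splits)
  have less: "choice v i < 2*n" if "i < n" for i using that by (auto simp: choice_def)
  let ?S = "insert (2*n) (choice v ` {..<n})"
  have S: "?S \<subseteq> {..2*n}" "card ?S = Suc n"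
  proof -
    show "?S \<subseteq> {..2*n}" using less by (auto intro: less_imp_le)
    have "2*n \<notin> choice v ` {..<n}" using less by fastforce
    thus "card ?S = Suc n" by (simp add: card_image[OF inj])
  qed
  obtain D0 where D0: "D0 \<in> circuits" "supp D0 = ?S" using circuit_exists[OF S] .
  obtain D where D: "D \<in> circuits" "2*n \<in> fst D" "supp D = ?S"
  proof (cases "2*n \<in> fst D0")
    case False
    hence "2*n \<in> snd D0" using D0(2) by (auto simp: supp_def)
    moreover have "opposite D0 \<in> circuits"
      using oriented_matroidD(3)[OF oriented_matroid_circuits D0(1)] .
    ultimately show ?thesis
      using that[of "opposite D0"] D0(2) by (auto simp: opposite_def supp_def)
  qed (use D0 that in blast)
  have "C = D"
    unfolding C_def fundamental_circuit_def B
  proof (rule the_equality)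
    show "D \<in> circuits \<and> 2*n \<in> fst D \<and> supp D \<subseteq> ?S" using D by simp
    fix Z assume Z: "Z \<in> circuits \<and> 2*n \<in> fst Z \<and> supp Z \<subseteq> ?S"
    hence "Z = D \<or> Z = opposite D"
      using oriented_matroidD(4)[OF oriented_matroid_circuits, of Z D] D by simp
    moreover have "2*n \<notin> fst (opposite D)"
      using D(2) circuitD(3)[OF D(1)] by (auto simp: opposite_def)
    ultimately show "Z = D" using Z by blast
  qed
  thus "C \<in> circuits" "2*n \<in> fst C" "supp C = ?S" using D by simp_all
qed

text \<open>In the fundamental circuit of \<open>q\<close>, the sign of the element of pair \<open>i\<close> is determined by the number
  of elements from there up to \<open>q\<close>. Up to the parity cancelled by the flips, this number counts
  the strict ancestors of \<open>i\<close> in \<open>v\<close>, and for \<open>i \<in> v\<close> the flips add \<open>i\<close> itself.\<close>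

lemma associated_USO_circuits:
  assumes v: "v \<subseteq> {..<n}"
  shows "associated_USO n circuits v = {j. j < n \<and> odd (card {d \<in> v. (d, j) \<in> E})}"
proof -
  define C where "C = fundamental_circuit circuits (({..<n} - v) \<union> (\<lambda>i. i + n) ` v) (2*n)"
  note C = fundamental_circuit_circuits[OF v, folded C_def]
  have less: "choice v i < 2*n" if "i < n" for i using that by (auto simp: choice_def)
  have inj: "inj_on (choice v) {..<n}"
    by (rule inj_onI) (auto simp: choice_def split: if_splits)
  have "(i \<in> snd C \<or> i + n \<in> snd C) \<longleftrightarrow> odd (card {d \<in> v. (d, i) \<in> E})" if i: "i < n" for i
  proof -
    let ?c = "choice v i"
    have c: "?c \<in> supp C" using i C(3) by auto
    have other: "i + n \<notin> supp C" if "i \<notin> v"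
      using that i v unfolding C(3) by (auto simp: choice_def split: if_splits)
    have other': "i \<notin> supp C" if "i \<in> v"
      using that i v unfolding C(3) by (auto simp: choice_def split: if_splits)
    have "(i \<in> snd C \<or> i + n \<in> snd C) \<longleftrightarrow> ?c \<in> snd C"
      using other other' by (auto simp: choice_def supp_def)
    also have "\<dots> \<longleftrightarrow> ?c \<notin> fst C"
      using c circuitD(3)[OF C(1)] unfolding supp_def by blast
    finally have sign: "(i \<in> snd C \<or> i + n \<in> snd C) \<longleftrightarrow> ?c \<notin> fst C" .
    have cq: "\<pi> ?c < \<pi> (2*n)" using less[OF i] by (simp add: \<pi>_q \<pi>_less)
    have "{f \<in> supp C. \<pi> ?c < \<pi> f \<and> \<pi> f \<le> \<pi> (2*n)} =
        insert (2*n) (choice v ` {j. j < n \<and> \<pi> ?c < \<pi> (choice v j)})"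
    proof -
      have "\<pi> (choice v j) \<le> \<pi> (2*n)" if "j < n" for j
        using less[OF that] by (simp add: \<pi>_q \<pi>_less less_imp_le)
      thus ?thesis using cq unfolding C(3) by auto
    qed
    moreover have "2*n \<notin> choice v ` {j. j < n \<and> \<pi> ?c < \<pi> (choice v j)}" using less by fastforce
    moreover have "card (choice v ` {j. j < n \<and> \<pi> ?c < \<pi> (choice v j)}) =
        openings_after ?c + card (strict_ancestors_in v i)"
      using card_choices_behind[OF i v] card_image[OF inj_on_subset[OF inj], of "{j. j < n \<and> \<pi> ?c < \<pi> (choice v j)}"]
      by auto
    ultimately have cnt: "card {f \<in> supp C. \<pi> ?c < \<pi> f \<and> \<pi> f \<le> \<pi> (2*n)} =
        Suc (openings_after ?c + card (strict_ancestors_in v i))"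
      by simp
    have "2*n \<notin> flips" by (simp add: flips_def)
    moreover have "2*n \<in> supp C" using C(3) by simp
    ultimately have pos: "?c \<in> fst C \<longleftrightarrow>
        (odd (openings_after ?c + card (strict_ancestors_in v i)) \<longleftrightarrow> ?c \<notin> flips)"
      using circuitD(4)[OF C(1) c _ less_imp_le[OF cq]] C(2) cnt by auto
    have "{d \<in> v. (d, i) \<in> E} =
        (if i \<in> v then insert i (strict_ancestors_in v i) else strict_ancestors_in v i)"
      using forestD(3)[OF i] by (auto simp: strict_ancestors_in_def)
    moreover have "i \<notin> strict_ancestors_in v i" by (simp add: strict_ancestors_in_def)
    ultimately have "odd (card {d \<in> v. (d, i) \<in> E}) \<longleftrightarrow>
        (odd (card (strict_ancestors_in v i)) \<longleftrightarrow> i \<notin> v)"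
      using finite_strict_ancestors_in by auto
    moreover have "?c \<in> flips \<longleftrightarrow> (i \<notin> v \<longleftrightarrow> even (openings_after ?c))"
      using i by (auto simp: flips_def choice_def)
    ultimately show ?thesis unfolding sign pos by auto
  qed
  thus ?thesis unfolding associated_USO_def C_def[symmetric] Let_def by auto
qed

end

theorem theorem4p5:
  fixes n :: nat and G :: "nat pair_pre_digraph" and m :: "nat set \<Rightarrow> nat set"
  assumes "n \<ge> 1"
    and "matousek_USO n G m"
  shows "(realizable n m \<longleftrightarrow>
            \<not> contains_induced G graph_G1 \<and> \<not> contains_induced G graph_G2) \<and>
         (realizable n m \<longrightarrow>
            (\<exists>\<C> \<pi> F. simple_extension_via n (2*n) \<pi> F \<C> \<and>
               (\<forall>v. v \<subseteq> {..<n} \<longrightarrow> m v = associated_USO n \<C> v)))"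
proof -
  have dig: "dimension_influence_graph n G" using assms(2) by (simp add: matousek_USO_def)
  have forest: "forest_order n (parcs G)"
    if "\<not> contains_induced G graph_G1 \<and> \<not> contains_induced G graph_G2"
    using forest_order_if_no_G1_G2[OF dig] that by blast
  have iff: "realizable n m \<longleftrightarrow>
      \<not> contains_induced G graph_G1 \<and> \<not> contains_induced G graph_G2"
    using realizable_imp_no_G1_G2[OF assms(2)] forest_imp_realizable[OF assms(2)] forest by blast
  have "\<exists>\<C> \<pi> F. simple_extension_via n (2*n) \<pi> F \<C> \<and>
      (\<forall>v. v \<subseteq> {..<n} \<longrightarrow> m v = associated_USO n \<C> v)" if "realizable n m"
  proof -
    interpret forest n "parcs G" by unfold_locales (use forest iff that in blast)
    obtain \<pi> where \<pi>: "\<pi> permutes {..<2*n}" "bracket_layout \<pi> {..<n}"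
      by (rule layout_permutation_exists)
    interpret forest_layout n "parcs G" \<pi> by unfold_locales (rule \<pi>)+
    have "m v = associated_USO n circuits v" if "v \<subseteq> {..<n}" for v
      using matousek_outmap[OF assms(2) that] associated_USO_circuits[OF that] by simp
    thus ?thesis using simple_extension_circuits by blast
  qed
  with iff show ?thesis by blast
qed

end
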